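(* For every integer $D\ge 3$ there exists an infinite family $\{G_n=(V,E)\}_{n\in\mathcal{I}}$ of bipartite $D$-regular graphs, where $G_n$ has $n$ vertices, such that for every $n\in\mathcal{I}$ the Hamiltonian $$H_n=\frac12\sum_{(u,v)\in E}(I-Z_uZ_v)$$ obeys $$\frac{1}{|E|}\langle +^n|U^{-1}H_nU|+^n\rangle\le \frac56+\frac{\sqrt{D-1}}{3D}$$ for every level-$p$ QAOA circuit $U=U(\beta,\gamma)$, $\beta,\gamma\in\mathbb{R}^p$, as long as $$p<\left(\tfrac13\log_2 n-4\right)D^{-1}.$$
   Context: Qubits are placed at the $n$ vertices of the graph $G_n$; $Z_u$ and $X_u$ denote the Pauli-$Z$ and Pauli-$X$ operators acting on qubit $u$, and $|+^n\rangle=|+\rangle^{\otimes n}$ with $|+\rangle=(|0\rangle+|1\rangle)/\sqrt2$. For an integer $p\ge1$ and $\beta=(\beta_1,\dots,\beta_p),\gamma=(\gamma_1,\dots,\gamma_p)\in\mathbb{R}^p$, the level-$p$ QAOA circuit for $H_n$ is $$U(\beta,\gamma)=\prod_{k=1}^p e^{i\beta_kB}e^{i\gamma_kH_n},\qquad B=\sum_{j=1}^nX_j .$$ The set $\mathcal{I}$ is an infinite set of positive integers (and $E$ depends on $n$). *)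

theory Defs
  imports
    Complex_Main
    "Jordan_Normal_Form.Gauss_Jordan_Elimination"
    "Jordan_Normal_Form.Conjugate"
begin

subsection \<open>Graphs\<close>

definition simple_graph :: "nat set \<Rightarrow> nat set set \<Rightarrow> bool" where
  "simple_graph V E \<longleftrightarrow> finite V \<and> (\<forall>e\<in>E. e \<subseteq> V \<and> card e = 2)"

definition regular_graph :: "nat \<Rightarrow> nat set \<Rightarrow> nat set set \<Rightarrow> bool" where
  "regular_graph D V E \<longleftrightarrow> simple_graph V E \<and> (\<forall>u\<in>V. card {e \<in> E. u \<in> e} = D)"

definition bipartite_graph :: "nat set \<Rightarrow> nat set set \<Rightarrow> bool" where
  "bipartite_graph V E \<longleftrightarrow> simple_graph V E \<and>
     (\<exists>L R. L \<union> R = V \<and> L \<inter> R = {} \<and> (\<forall>e\<in>E. \<exists>l\<in>L. \<exists>r\<in>R. e = {l, r}))"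


subsection \<open>Systems of \<open>n\<close> qubits\<close>

text \<open>
  The state space of the qubits \<open>0, \<dots>, n - 1\<close> has dimension \<open>2 ^ n\<close>. The computational basis
  state with index \<open>x < 2 ^ n\<close> assigns to qubit \<open>u\<close> the binary digit \<open>bit x u\<close> of \<open>x\<close>. The two
  functions below are the tensor products, in this basis, of one-qubit operators (resp. states),
  where \<open>A u\<close> (resp. \<open>\<psi> u\<close>) is the factor at qubit \<open>u\<close>.
\<close>

definition tensor_op :: "nat \<Rightarrow> (nat \<Rightarrow> complex mat) \<Rightarrow> complex mat" where
  "tensor_op n A = mat (2 ^ n) (2 ^ n)
     (\<lambda>(x, y). \<Prod>u<n. A u $$ (of_bool (bit x u), of_bool (bit y u)))"

definition tensor_state :: "nat \<Rightarrow> (nat \<Rightarrow> complex vec) \<Rightarrow> complex vec" where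
  "tensor_state n \<psi> = vec (2 ^ n) (\<lambda>x. \<Prod>u<n. \<psi> u $ of_bool (bit x u))"

definition on_qubit :: "nat \<Rightarrow> nat \<Rightarrow> complex mat \<Rightarrow> complex mat" where
  "on_qubit n u A = tensor_op n (\<lambda>v. if v = u then A else 1\<^sub>m 2)"

definition pauli_X :: "nat \<Rightarrow> nat \<Rightarrow> complex mat" where
  "pauli_X n u = on_qubit n u (mat_of_rows_list 2 [[0, 1], [1, 0]])"

definition pauli_Z :: "nat \<Rightarrow> nat \<Rightarrow> complex mat" where
  "pauli_Z n u = on_qubit n u (mat_of_rows_list 2 [[1, 0], [0, -1]])"

definition plus_state :: "nat \<Rightarrow> complex vec" where
  "plus_state n =
     tensor_state n (\<lambda>_. vec_of_list [1 / complex_of_real (sqrt 2), 1 / complex_of_real (sqrt 2)])"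

text \<open>The sum of a family of \<open>N \<times> N\<close> matrices over a finite index set.\<close>

definition mat_sum :: "nat \<Rightarrow> ('a \<Rightarrow> complex mat) \<Rightarrow> 'a set \<Rightarrow> complex mat" where
  "mat_sum N F S = mat N N (\<lambda>(i, j). \<Sum>s\<in>S. F s $$ (i, j))"

text \<open>The exponential of a square matrix; its power series converges in every entry.\<close>

definition mat_exp :: "complex mat \<Rightarrow> complex mat" where
  "mat_exp A = mat (dim_row A) (dim_row A) (\<lambda>(i, j). \<Sum>k. (A ^\<^sub>m k) $$ (i, j) / fact k)"

text \<open>The inner product \<open>\<bullet>c\<close> conjugates its second argument, so this is
  \<open>\<langle>\<psi>|A|\<psi>\<rangle>\<close>.\<close>

definition expectation_value :: "complex mat \<Rightarrow> complex vec \<Rightarrow> complex" where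
  "expectation_value A \<psi> = (A *\<^sub>v \<psi>) \<bullet>c \<psi>"


subsection \<open>QAOA for the Ising Hamiltonian of a graph\<close>

text \<open>
  \<open>Min e\<close> and \<open>Max e\<close> are the two endpoints of the edge \<open>e\<close>; their order is irrelevant, as
  \<open>Z\<close> operators commute.
\<close>

definition ising_hamiltonian :: "nat \<Rightarrow> nat set set \<Rightarrow> complex mat" where
  "ising_hamiltonian n E =
     (1 / 2) \<cdot>\<^sub>m mat_sum (2 ^ n) (\<lambda>e. 1\<^sub>m (2 ^ n) - pauli_Z n (Min e) * pauli_Z n (Max e)) E"

definition mixer :: "nat \<Rightarrow> complex mat" where
  "mixer n = mat_sum (2 ^ n) (pauli_X n) {..<n}"

text \<open>
  \<open>qaoa_circuit n H p \<beta> \<gamma>\<close> is the product over \<open>k = 1, \<dots>, p\<close>, from left to right, of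
  \<open>exp (i \<beta>\<^sub>k B) exp (i \<gamma>\<^sub>k H)\<close>. Only the values \<open>\<beta> k\<close>, \<open>\<gamma> k\<close> with \<open>1 \<le> k \<le> p\<close> are used.
\<close>

primrec qaoa_circuit ::
  "nat \<Rightarrow> complex mat \<Rightarrow> nat \<Rightarrow> (nat \<Rightarrow> real) \<Rightarrow> (nat \<Rightarrow> real) \<Rightarrow> complex mat" where
  "qaoa_circuit n H 0 \<beta> \<gamma> = 1\<^sub>m (2 ^ n)"
| "qaoa_circuit n H (Suc p) \<beta> \<gamma> = qaoa_circuit n H p \<beta> \<gamma> *
     (mat_exp ((\<i> * complex_of_real (\<beta> (Suc p))) \<cdot>\<^sub>m mixer n) *
      mat_exp ((\<i> * complex_of_real (\<gamma> (Suc p))) \<cdot>\<^sub>m H))"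

text \<open>
  The value \<open>\<langle>+\<^sup>n|U\<^sup>-\<^sup>1 H U|+\<^sup>n\<rangle>\<close>. The circuit is unitary, so
  \<open>mat_inverse\<close> does return its inverse, and \<open>H\<close> is Hermitian, so taking the real part only
  changes the type.
\<close>

definition qaoa_energy ::
  "nat \<Rightarrow> nat set set \<Rightarrow> nat \<Rightarrow> (nat \<Rightarrow> real) \<Rightarrow> (nat \<Rightarrow> real) \<Rightarrow> real" where
  "qaoa_energy n E p \<beta> \<gamma> =
     (let H = ising_hamiltonian n E; U = qaoa_circuit n H p \<beta> \<gamma>
      in Re (expectation_value (the (mat_inverse U) * H * U) (plus_state n)))"

end

theory Submission
  imports
    Defs
    "HOL-Combinatorics.Permutations"
    "HOL-Library.FuncSet"
    "HOL-Library.Nat_Bijection"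
    "HOL-Real_Asymp.Real_Asymp"
begin

text \<open>
  Measuring the QAOA state yields a random vertex set, whose expected cut is the energy. In the
  Heisenberg picture \<open>Z\<^sub>u\<close> stays supported on the ball of radius \<open>p\<close> around \<open>u\<close>, and it is odd under
  flipping all qubits because the circuit commutes with this flip. Hence flipping only that ball
  shows \<open>\<langle>Z\<^sub>uZ\<^sub>v\<rangle> = 0\<close> when the balls of \<open>u\<close> and \<open>v\<close> are disjoint. For \<open>p\<close> below the stated bound a ball
  overlaps only \<open>O(n\<^bsup>2/3\<^esup>)\<close> others, so by Chebyshev the measured set contains nearly half of
  each side of the bipartition.

  It therefore suffices that every such set leaves slightly more than the fraction
  \<open>c = (1 - 2 sqrt (D - 1) / D) / 6\<close> of the edges uncut. No Ramanujan graphs are needed for this: a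
  union of \<open>D\<close> random perfect matchings has the property by an exponential moment
  bound, with few double edges, and the double edges can be switched away one by one.
\<close>

subsection \<open>Random matchings\<close>

text \<open>The bipartition itself cuts every edge, so no bound over all cuts can work; balance
  excludes this cut. Balance enters on the left side only: the left part \<open>A\<close> has size
  within \<open>\<epsilon> * m\<close> of \<open>m / 2\<close>, while the right part
  \<open>B\<close> is arbitrary and costs a factor \<open>2 ^ m\<close> in the union bound. Since
  \<open>c\<close> is below \<open>1 / 6\<close> for every \<open>D\<close>, and at most
  \<open>1 / 30\<close> for \<open>D \<le> 5\<close>, a crude first moment affords this.

  The construction gives a strict gap \<open>f > c\<close>, which is why the final bound carries no
  error term. The gap pays for two losses of lower order than the number \<open>D * m\<close> of
  edges: the switchings, at most \<open>2 * D ^ 2\<close> in number and each lowering a defect by at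
  most 2, and the Chebyshev error, of order \<open>m powr (- 1 / 3)\<close> relative to the number
  of edges. The second moment is taken about \<open>m / 2\<close> directly: pairs of qubits with
  disjoint light cones contribute zero to it, so expectations of single qubits never have to be
  computed.\<close>

lemma ex_permutes_image_eq:
  assumes "finite S" "A \<subseteq> S" "B \<subseteq> S" "card A = card B"
  shows "\<exists>\<sigma>. \<sigma> permutes S \<and> \<sigma> ` A = B"
proof -
  have fin: "finite A" "finite B" using assms finite_subset by auto
  obtain f where f: "bij_betw f A B"
    using assms(4) fin finite_same_card_bij by blast
  have "card (S - A) = card (S - B)"
    using assms fin by (simp add: card_Diff_subset)
  then obtain g where g: "bij_betw g (S - A) (S - B)"
    using assms(1) by (meson finite_Diff finite_same_card_bij)
  define \<sigma> where "\<sigma> x = (if x \<in> A then f x else if x \<in> S then g x else x)" for x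
  have "bij_betw \<sigma> (A \<union> (S - A)) (B \<union> (S - B))"
  proof (rule bij_betw_combine)
    show "bij_betw \<sigma> A B" using f by (subst bij_betw_cong[of _ _ f]) (auto simp: \<sigma>_def)
    show "bij_betw \<sigma> (S - A) (S - B)"
      using g by (subst bij_betw_cong[of _ _ g]) (auto simp: \<sigma>_def)
  qed auto
  then have "bij_betw \<sigma> S S" using assms(2,3) by (simp add: Un_absorb1)
  then have "\<sigma> permutes S" using assms(2) by (intro bij_imp_permutes) (auto simp: \<sigma>_def)
  moreover have "\<sigma> ` A = B" using f by (auto simp: \<sigma>_def bij_betw_def)
  ultimately show ?thesis by blast
qed

text \<open>Left composition with a permutation carrying \<open>C\<close> to \<open>C'\<close>
  embeds the fibre over \<open>C\<close> into the fibre over \<open>C'\<close>. So the fibres over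
  all sets of size \<open>card A\<close> are equally large, and together they exhaust the
  permutations.\<close>

lemma card_permutes_image_eq:
  assumes S: "finite S" and A: "A \<subseteq> S" and B: "B \<subseteq> S" "card B = card A"
  shows "card {\<pi>. \<pi> permutes S \<and> \<pi> ` A = B} * (card S choose card A) = fact (card S)"
proof -
  define N where "N C = card {\<pi>. \<pi> permutes S \<and> \<pi> ` A = C}" for C
  have finP: "finite {\<pi>. \<pi> permutes S}" using S by (rule finite_permutations)
  have N_le: "N C \<le> N C'" if C: "C \<subseteq> S" "C' \<subseteq> S" "card C = card C'" for C C'
  proof -
    obtain \<sigma> where \<sigma>: "\<sigma> permutes S" "\<sigma> ` C = C'"
      using ex_permutes_image_eq[OF S C] by blast
    show ?thesis unfolding N_def
    proof (rule card_inj_on_le[where f = "\<lambda>\<pi>. \<sigma> \<circ> \<pi>"])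
      show "inj_on ((\<circ>) \<sigma>) {\<pi>. \<pi> permutes S \<and> \<pi> ` A = C}"
        by (rule inj_onI) (metis \<sigma>(1) fun.inj_map_strong permutes_def comp_apply ext)
      show "(\<circ>) \<sigma> ` {\<pi>. \<pi> permutes S \<and> \<pi> ` A = C} \<subseteq> {\<pi>. \<pi> permutes S \<and> \<pi> ` A = C'}"
        using \<sigma> by (auto simp: permutes_compose image_comp[symmetric])
      show "finite {\<pi>. \<pi> permutes S \<and> \<pi> ` A = C'}" using finP by (rule rev_finite_subset) auto
    qed
  qed
  define F where "F = {C. C \<subseteq> S \<and> card C = card A}"
  have F: "finite F" using S by (auto simp: F_def)
  have "fact (card S) = card (\<Union>C\<in>F. {\<pi>. \<pi> permutes S \<and> \<pi> ` A = C})"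
  proof -
    have "\<pi> ` A \<in> F" if "\<pi> permutes S" for \<pi>
      using that A by (auto simp: F_def permutes_in_image subset_iff card_image permutes_inj_on)
    then have "(\<Union>C\<in>F. {\<pi>. \<pi> permutes S \<and> \<pi> ` A = C}) = {\<pi>. \<pi> permutes S}" by blast
    then show ?thesis using card_permutations[OF refl S] by simp
  qed
  also have "\<dots> = (\<Sum>C\<in>F. N C)"
    unfolding N_def using F finP by (intro card_UN_disjoint) (auto intro: rev_finite_subset)
  also have "\<dots> = (\<Sum>C\<in>F. N B)"
    using B N_le by (intro sum.cong refl antisym) (auto simp: F_def)
  also have "\<dots> = N B * (card S choose card A)"
    using n_subsets[OF S] by (simp add: F_def)
  finally show ?thesis by (simp add: N_def)
qed

text \<open>A uniformly random permutation sends \<open>A\<close> to a uniformly random set of the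
  same size. This replaces the average over a matching by a sum over subsets.\<close>

lemma sum_permutes_image:
  fixes g :: "'a set \<Rightarrow> real"
  assumes S: "finite S" and A: "A \<subseteq> S"
  shows "(\<Sum>\<pi> | \<pi> permutes S. g (\<pi> ` A)) =
    fact (card S) / (card S choose card A) * (\<Sum>B | B \<subseteq> S \<and> card B = card A. g B)"
proof -
  define F where "F = {B. B \<subseteq> S \<and> card B = card A}"
  have F: "finite F" using S by (auto simp: F_def)
  have finP: "finite {\<pi>. \<pi> permutes S}" using S by (rule finite_permutations)
  have im: "\<pi> ` A \<in> F" if "\<pi> permutes S" for \<pi>
    using that A by (auto simp: F_def permutes_in_image subset_iff card_image permutes_inj_on)
  have "(\<Sum>\<pi> | \<pi> permutes S. g (\<pi> ` A)) =
      (\<Sum>B\<in>F. \<Sum>\<pi> | \<pi> \<in> {\<pi>. \<pi> permutes S} \<and> \<pi> ` A = B. g (\<pi> ` A))"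
    by (rule sum.group[symmetric]) (use F finP im in auto)
  also have "\<dots> = (\<Sum>B\<in>F. fact (card S) / (card S choose card A) * g B)"
  proof (rule sum.cong)
    fix B assume B: "B \<in> F"
    have "real (card {\<pi>. \<pi> permutes S \<and> \<pi> ` A = B} * (card S choose card A)) = real (fact (card S))"
      using card_permutes_image_eq[OF S A] B by (simp only: F_def mem_Collect_eq)
    moreover have "(card S choose card A) > 0"
      using card_mono[OF S A] by simp
    ultimately have "real (card {\<pi>. \<pi> permutes S \<and> \<pi> ` A = B}) = fact (card S) / (card S choose card A)"
      by (simp add: field_simps)
    then show "(\<Sum>\<pi> | \<pi> \<in> {\<pi>. \<pi> permutes S} \<and> \<pi> ` A = B. g (\<pi> ` A)) =
        fact (card S) / (card S choose card A) * g B" by simp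
  qed simp
  finally show ?thesis by (simp add: F_def sum_distrib_left)
qed

section \<open>Exponential moments of the defect and expected collisions\<close>

lemma sum_Pow_power_card:
  fixes z :: "'b :: comm_semiring_1"
  assumes "finite S"
  shows "(\<Sum>A\<in>Pow S. z ^ card A) = (1 + z) ^ card S"
  using assms
proof (induction S)
  case (insert x S)
  have "(\<Sum>A\<in>Pow (insert x S). z ^ card A) =
      (\<Sum>A\<in>Pow S. z ^ card A) + (\<Sum>A\<in>insert x ` Pow S. z ^ card A)"
    unfolding Pow_insert using insert by (intro sum.union_disjoint) auto
  also have "(\<Sum>A\<in>insert x ` Pow S. z ^ card A) = (\<Sum>A\<in>Pow S. z ^ card (insert x A))"
    using insert(2) by (intro sum.reindex[unfolded comp_def] inj_onI) (metis PowD insert_ident subsetD)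
  also have "\<dots> = (\<Sum>A\<in>Pow S. z * z ^ card A)"
    using insert by (intro sum.cong refl, subst card_insert_disjoint) (auto intro: finite_subset)
  finally show ?case using insert by (simp add: sum_distrib_left[symmetric] algebra_simps)
qed simp

lemma sum_Pow_power_card_sym_diff:
  fixes z :: "'b :: comm_semiring_1"
  assumes "finite S" "B \<subseteq> S"
  shows "(\<Sum>A\<in>Pow S. z ^ card (sym_diff A B)) = (1 + z) ^ card S"
proof -
  have "(\<Sum>A\<in>Pow S. z ^ card (sym_diff A B)) = (\<Sum>A\<in>Pow S. z ^ card A)"
    by (rule sum.reindex_bij_witness[where i = "\<lambda>A. sym_diff A B" and j = "\<lambda>A. sym_diff A B"])
      (use assms in auto)
  then show ?thesis using sum_Pow_power_card[OF assms(1)] by simp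
qed

text \<open>If \<open>A\<close> is one part of a cut on the left side and \<open>B\<close> is the other part on the right side, this is the
  number of edges of the matchings \<open>\<pi>\<close> that are not cut.\<close>

definition defect :: "nat \<Rightarrow> (nat \<Rightarrow> nat \<Rightarrow> nat) \<Rightarrow> nat set \<Rightarrow> nat set \<Rightarrow> nat" where
  "defect D \<pi> A B = (\<Sum>i<D. card (sym_diff (\<pi> i ` A) B))"

text \<open>Pairs \<open>(i, j)\<close> are ordered, so each coincidence of two matchings at
  \<open>u\<close> counts twice. Emptiness means that the union of the matchings has no double
  edges.\<close>

definition collisions :: "nat \<Rightarrow> nat \<Rightarrow> (nat \<Rightarrow> nat \<Rightarrow> nat) \<Rightarrow> (nat \<times> nat \<times> nat) set" where
  "collisions D m \<pi> = {(i, j, u). i < D \<and> j < D \<and> i \<noteq> j \<and> u < m \<and> \<pi> i u = \<pi> j u}"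

lemma finite_collisions [simp]: "finite (collisions D m \<pi>)"
  by (rule finite_subset[of _ "{..<D} \<times> {..<D} \<times> {..<m}"]) (auto simp: collisions_def)

text \<open>The matchings are independent, so the sum factorises into \<open>D\<close> equal
  factors. \<open>K\<close> is a lower bound for the binomial coefficient that normalises each of
  them.\<close>

lemma sum_power_defect_le:
  fixes z :: real
  assumes z: "z > 0" and A: "A \<subseteq> {..<m}" and B: "B \<subseteq> {..<m}"
    and K: "0 < K" "K \<le> real (m choose card A)"
  shows "(\<Sum>\<pi>\<in>PiE {..<D} (\<lambda>_. {\<pi>. \<pi> permutes {..<m}}). z ^ defect D \<pi> A B)
    \<le> (fact m * ((1 + z) ^ m / K)) ^ D"
proof -
  have fin: "finite {\<pi>. \<pi> permutes {..<m}}" by (rule finite_permutations) simp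
  have "(\<Sum>\<pi>\<in>PiE {..<D} (\<lambda>_. {\<pi>. \<pi> permutes {..<m}}). z ^ defect D \<pi> A B) =
      (\<Sum>\<pi>\<in>PiE {..<D} (\<lambda>_. {\<pi>. \<pi> permutes {..<m}}). \<Prod>i<D. z ^ card (sym_diff (\<pi> i ` A) B))"
    by (simp add: defect_def power_sum)
  also have "\<dots> = (\<Prod>i<D. \<Sum>\<pi> | \<pi> permutes {..<m}. z ^ card (sym_diff (\<pi> ` A) B))"
    using fin by (subst prod_sum_PiE) auto
  also have "\<dots> = (\<Sum>\<pi> | \<pi> permutes {..<m}. z ^ card (sym_diff (\<pi> ` A) B)) ^ D" by simp
  also have "\<dots> \<le> (fact m * ((1 + z) ^ m / K)) ^ D"
  proof (rule power_mono)
    have "(\<Sum>\<pi> | \<pi> permutes {..<m}. z ^ card (sym_diff (\<pi> ` A) B)) = fact m / (m choose card A) *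
        (\<Sum>C | C \<subseteq> {..<m} \<and> card C = card A. z ^ card (sym_diff C B))"
      using sum_permutes_image[OF _ A, of "\<lambda>C. z ^ card (sym_diff C B)"] by simp
    \<comment> \<open>Letting \<open>C\<close> range over all subsets makes the sum a full power of
      \<open>1 + z\<close>, whatever \<open>B\<close> is. For sizes near \<open>m / 2\<close> little
      is lost, because \<open>m choose card A\<close> is then close to \<open>2 ^ m\<close> on the
      exponential scale.\<close>
    also have "\<dots> \<le> fact m / K * (\<Sum>C\<in>Pow {..<m}. z ^ card (sym_diff C B))"
      using K z card_mono[OF _ A]
      by (intro mult_mono divide_left_mono sum_mono2 sum_nonneg mult_pos_pos) auto
    also have "\<dots> = fact m * ((1 + z) ^ m / K)"
      using sum_Pow_power_card_sym_diff[OF _ B, of z] by simp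
    finally show "(\<Sum>\<pi> | \<pi> permutes {..<m}. z ^ card (sym_diff (\<pi> ` A) B)) \<le> fact m * ((1 + z) ^ m / K)" .
    show "0 \<le> (\<Sum>\<pi> | \<pi> permutes {..<m}. z ^ card (sym_diff (\<pi> ` A) B))"
      using z by (intro sum_nonneg) auto
  qed
  finally show ?thesis .
qed

lemma card_permutes_maps_to:
  assumes "u < m" "v < m"
  shows "real (card {\<pi>. \<pi> permutes {..<m} \<and> \<pi> u = v}) = fact m / m"
proof -
  have "card {\<pi>. \<pi> permutes {..<m} \<and> \<pi> ` {u} = {v}} * (m choose 1) = fact m"
    using card_permutes_image_eq[of "{..<m}" "{u}" "{v}"] assms by simp
  then have "real (card {\<pi>. \<pi> permutes {..<m} \<and> \<pi> u = v} * m) = real (fact m)" by simp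
  then show ?thesis using assms by (simp add: field_simps)
qed

text \<open>Two independent uniform permutations agree at \<open>u\<close> with probability
  \<open>1 / m\<close>. Summed over \<open>u\<close> this is 1 per ordered pair of matchings, so the
  expected number of collisions stays bounded as \<open>m\<close> grows.\<close>

lemma sum_card_collisions_le:
  shows "(\<Sum>\<pi>\<in>PiE {..<D} (\<lambda>_. {\<pi>. \<pi> permutes {..<m}}). real (card (collisions D m \<pi>)))
    \<le> real (D ^ 2) * fact m ^ D"
proof -
  define P where "P = {\<pi>. \<pi> permutes {..<m}}"
  define T where "T = PiE {..<D} (\<lambda>_. P)"
  have fin: "finite P" unfolding P_def by (rule finite_permutations) simp
  have finT: "finite T" using fin by (auto simp: T_def intro: finite_PiE)
  have cardP: "card P = fact m" unfolding P_def using card_permutations[of "{..<m}" m] by simp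
  define Q where "Q = {(i, j). i < D \<and> j < D \<and> i \<noteq> j}"
  have finQ: "finite Q" by (rule finite_subset[of _ "{..<D} \<times> {..<D}"]) (auto simp: Q_def)
  have cardQ: "card Q \<le> D ^ 2"
  proof -
    have "card Q \<le> card ({..<D} \<times> {..<D})" by (rule card_mono) (auto simp: Q_def)
    then show ?thesis by (simp add: power2_eq_square)
  qed
  have one: "(\<Sum>\<pi>\<in>T. of_bool (\<pi> i u = \<pi> j u)) = (fact m ^ D / m :: real)"
    if ij: "i < D" "j < D" "i \<noteq> j" and u: "u < m" for i j u
  proof -
    \<comment> \<open>Splitting by the common value \<open>v\<close> turns the event into a product
      over \<open>k\<close>, with factor 1 for the other matchings, so that the sum over
      \<open>T\<close> factorises.\<close>
    have "(\<Sum>\<pi>\<in>T. of_bool (\<pi> i u = \<pi> j u)) =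
        (\<Sum>\<pi>\<in>T. \<Sum>v<m. \<Prod>k<D. (if k = i \<or> k = j then of_bool (\<pi> k u = v) else 1) :: real)"
    proof (rule sum.cong[OF refl])
      fix \<pi> assume \<pi>: "\<pi> \<in> T"
      have "\<pi> i permutes {..<m}" using \<pi> ij by (auto simp: T_def P_def)
      then have lt: "\<pi> i u < m" using u permutes_in_image by fastforce
      have "(\<Prod>k<D. (if k = i \<or> k = j then of_bool (\<pi> k u = v) else 1) :: real) =
          of_bool (\<pi> i u = v) * of_bool (\<pi> j u = v)" for v
      proof -
        have "(\<Prod>k<D. (if k = i \<or> k = j then of_bool (\<pi> k u = v) else 1) :: real) =
            (\<Prod>k\<in>{i, j}. (if k = i \<or> k = j then of_bool (\<pi> k u = v) else 1) :: real)"
          using ij by (intro prod.mono_neutral_right) auto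
        then show ?thesis using ij by simp
      qed
      then have "(\<Sum>v<m. \<Prod>k<D. (if k = i \<or> k = j then of_bool (\<pi> k u = v) else 1) :: real) =
          (\<Sum>v<m. if v = \<pi> i u then of_bool (\<pi> i u = \<pi> j u) else 0)"
        by (auto intro!: sum.cong)
      also have "\<dots> = of_bool (\<pi> i u = \<pi> j u)" using lt by simp
      finally show "of_bool (\<pi> i u = \<pi> j u) =
        (\<Sum>v<m. \<Prod>k<D. (if k = i \<or> k = j then of_bool (\<pi> k u = v) else 1) :: real)" by simp
    qed
    also have "\<dots> = (\<Sum>v<m. \<Sum>\<pi>\<in>T. \<Prod>k<D. (if k = i \<or> k = j then of_bool (\<pi> k u = v) else 1))"
      by (rule sum.swap)
    also have "\<dots> = (\<Sum>v<m. \<Prod>k<D. \<Sum>\<sigma>\<in>P. (if k = i \<or> k = j then of_bool (\<sigma> u = v) else 1))"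
      unfolding T_def using fin by (subst prod_sum_PiE) auto
    also have "\<dots> = (\<Sum>v<m. (fact m) ^ D / m ^ 2)"
    proof (rule sum.cong[OF refl])
      fix v assume v: "v \<in> {..<m}"
      have c: "(\<Sum>\<sigma>\<in>P. of_bool (\<sigma> u = v)) = (fact m / m :: real)"
        using card_permutes_maps_to[of u m v] u v fin
        by (simp add: P_def of_bool_def sum.If_cases Collect_conj_eq[symmetric])
      have "(\<Prod>k<D. \<Sum>\<sigma>\<in>P. (if k = i \<or> k = j then of_bool (\<sigma> u = v) else 1 :: real)) =
          (\<Prod>k<D. fact m * (if k = i then 1 / m else 1) * (if k = j then 1 / m else 1))"
        using c ij by (intro prod.cong) (auto simp: cardP)
      also have "\<dots> = fact m ^ D * (1 / m) * (1 / m)"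
        using ij by (simp add: prod.distrib)
      finally show "(\<Prod>k<D. \<Sum>\<sigma>\<in>P. (if k = i \<or> k = j then of_bool (\<sigma> u = v) else 1 :: real)) =
          fact m ^ D / m ^ 2" by (simp add: power2_eq_square)
    qed
    also have "\<dots> = fact m ^ D / m" using u by (simp add: power2_eq_square)
    finally show ?thesis .
  qed
  have "(\<Sum>\<pi>\<in>T. real (card (collisions D m \<pi>))) =
      (\<Sum>\<pi>\<in>T. \<Sum>(i, j)\<in>Q. \<Sum>u<m. of_bool (\<pi> i u = \<pi> j u))"
  proof (rule sum.cong[OF refl])
    fix \<pi>
    have "real (card (collisions D m \<pi>)) = (\<Sum>(i, j)\<in>Q. real (card {u \<in> {..<m}. \<pi> i u = \<pi> j u}))"
    proof -
      define g where "g x = (fst (fst x), snd (fst x), snd x)" for x :: "(nat \<times> nat) \<times> nat"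
      have "collisions D m \<pi> = g ` (SIGMA x:Q. {u \<in> {..<m}. \<pi> (fst x) u = \<pi> (snd x) u})"
        by (force simp: collisions_def Q_def g_def)
      moreover have inj: "inj_on g X" for X by (auto simp: inj_on_def g_def prod_eq_iff)
      ultimately have "card (collisions D m \<pi>) =
          card (SIGMA x:Q. {u \<in> {..<m}. \<pi> (fst x) u = \<pi> (snd x) u})"
        by (simp only: card_image[OF inj])
      then show ?thesis using finQ by (simp add: case_prod_unfold)
    qed
    then show "real (card (collisions D m \<pi>)) = (\<Sum>(i, j)\<in>Q. \<Sum>u<m. of_bool (\<pi> i u = \<pi> j u))"
      by (simp add: of_bool_def sum.If_cases Int_def)
  qed
  also have "\<dots> = (\<Sum>(i, j)\<in>Q. \<Sum>u<m. \<Sum>\<pi>\<in>T. of_bool (\<pi> i u = \<pi> j u))"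
    unfolding case_prod_unfold by (subst sum.swap, rule sum.cong[OF refl], rule sum.swap)
  also have "\<dots> = (\<Sum>(i, j)\<in>Q. \<Sum>u<m. fact m ^ D / m)"
    by (intro sum.cong refl) (auto simp: Q_def one intro!: sum.cong)
  also have "\<dots> \<le> (\<Sum>(i, j)\<in>Q. fact m ^ D)" by (intro sum_mono) (auto simp: Q_def)
  also have "\<dots> = real (card Q) * fact m ^ D" by simp
  also have "\<dots> \<le> real (D ^ 2) * fact m ^ D" using cardQ by (intro mult_right_mono) auto
  finally show ?thesis by (simp add: T_def P_def)
qed

text \<open>First moment method for two requirements at once:
  \<open>W \<pi> / z powr t + c \<pi> / (2 * D ^ 2)\<close> has average below 1, each term
  contributing at most one half. So some \<open>\<pi>\<close> makes both terms less than 1, and as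
  \<open>z < 1\<close>, the first then forces every defect to be at least \<open>t\<close>. The
  factor \<open>4 ^ m\<close> bounds the number of pairs \<open>(A, B)\<close>.\<close>

lemma exists_matchings_few_collisions:
  fixes z t K :: real
  assumes z: "0 < z" "z < 1" and K: "0 < K" and D: "D > 0"
    and \<A>: "\<And>A. A \<in> \<A> \<Longrightarrow> A \<subseteq> {..<m} \<and> K \<le> real (m choose card A)"
    and small: "4 ^ m * ((1 + z) ^ m / K) ^ D < z powr t / 2"
  shows "\<exists>\<pi>. (\<forall>i<D. \<pi> i permutes {..<m}) \<and> card (collisions D m \<pi>) \<le> 2 * D ^ 2 \<and>
    (\<forall>A\<in>\<A>. \<forall>B\<subseteq>{..<m}. t \<le> real (defect D \<pi> A B))"
proof -
  define T where "T = PiE {..<D} (\<lambda>_. {\<pi>. \<pi> permutes {..<m}})"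
  have finP: "finite {\<pi>. \<pi> permutes {..<m}}" by (rule finite_permutations) simp
  have finT: "finite T" using finP by (auto simp: T_def intro: finite_PiE)
  have cardT: "card T = fact m ^ D"
    using card_permutations[of "{..<m}" m] by (simp add: T_def card_PiE)
  have \<A>_sub: "\<A> \<subseteq> Pow {..<m}" using \<A> by auto
  have fin\<A>: "finite \<A>" by (rule finite_subset[OF \<A>_sub]) simp
  have card\<A>: "card \<A> \<le> 2 ^ m"
    using card_mono[OF _ \<A>_sub] by (simp add: card_Pow)
  define W where "W \<pi> = (\<Sum>A\<in>\<A>. \<Sum>B\<in>Pow {..<m}. z ^ defect D \<pi> A B)" for \<pi>
  define c where "c \<pi> = real (card (collisions D m \<pi>))" for \<pi>
  have "(\<Sum>\<pi>\<in>T. W \<pi>) = (\<Sum>A\<in>\<A>. \<Sum>B\<in>Pow {..<m}. \<Sum>\<pi>\<in>T. z ^ defect D \<pi> A B)"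
    unfolding W_def by (subst sum.swap, rule sum.cong[OF refl], rule sum.swap)
  also have "\<dots> \<le> (\<Sum>A\<in>\<A>. \<Sum>B\<in>Pow {..<m}. (fact m * ((1 + z) ^ m / K)) ^ D)"
    unfolding T_def using \<A> K z by (intro sum_mono sum_power_defect_le) auto
  also have "\<dots> = real (card \<A>) * 2 ^ m * (fact m * ((1 + z) ^ m / K)) ^ D"
    by (simp add: card_Pow)
  also have "\<dots> \<le> 2 ^ m * 2 ^ m * (fact m * ((1 + z) ^ m / K)) ^ D"
    using card\<A> K z by (intro mult_right_mono) (auto simp: numeral_power_le_of_nat_cancel_iff)
  also have "\<dots> = fact m ^ D * (4 ^ m * ((1 + z) ^ m / K) ^ D)"
    by (simp add: power_mult_distrib power_divide flip: power_mult_distrib[of 2 2 m])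
  also have "\<dots> < fact m ^ D * (z powr t / 2)"
    using small by (intro mult_strict_left_mono) auto
  finally have W: "(\<Sum>\<pi>\<in>T. W \<pi>) < fact m ^ D * (z powr t / 2)" .
  have c: "(\<Sum>\<pi>\<in>T. c \<pi>) \<le> real (D ^ 2) * fact m ^ D"
    unfolding c_def T_def by (rule sum_card_collisions_le)
  have "(\<Sum>\<pi>\<in>T. W \<pi> / z powr t + c \<pi> / (2 * D ^ 2)) =
      (\<Sum>\<pi>\<in>T. W \<pi>) / z powr t + (\<Sum>\<pi>\<in>T. c \<pi>) / (2 * D ^ 2)"
    by (simp add: sum.distrib sum_divide_distrib)
  also have "\<dots> < fact m ^ D * (z powr t / 2) / z powr t + real (D ^ 2) * fact m ^ D / (2 * D ^ 2)"
    using W c z D by (intro add_less_le_mono divide_strict_right_mono divide_right_mono) auto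
  also have "\<dots> = (\<Sum>\<pi>\<in>T. 1)" using z D by (simp add: cardT field_simps)
  finally obtain \<pi> where \<pi>: "\<pi> \<in> T" "W \<pi> / z powr t + c \<pi> / (2 * D ^ 2) < 1"
    by (meson not_le sum_mono)
  have W_nonneg: "W \<pi> \<ge> 0" using z by (auto simp: W_def intro!: sum_nonneg)
  have c_nonneg: "c \<pi> \<ge> 0" by (simp add: c_def)
  have W1: "W \<pi> / z powr t < 1" and c1: "c \<pi> / (2 * D ^ 2) < 1"
    using \<pi>(2) divide_nonneg_nonneg[OF W_nonneg, of "z powr t"] divide_nonneg_nonneg[OF c_nonneg, of "2 * D ^ 2"]
    by auto
  have "t \<le> real (defect D \<pi> A B)" if AB: "A \<in> \<A>" "B \<subseteq> {..<m}" for A B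
  proof -
    have "z ^ defect D \<pi> A B \<le> (\<Sum>B\<in>Pow {..<m}. z ^ defect D \<pi> A B)"
      using AB z by (intro member_le_sum) auto
    also have "\<dots> \<le> W \<pi>"
      unfolding W_def using AB z fin\<A>
      by (intro member_le_sum[of A \<A> "\<lambda>A. \<Sum>B\<in>Pow {..<m}. z ^ defect D \<pi> A B"] sum_nonneg) auto
    also have "\<dots> < z powr t" using W1 z by (simp add: field_simps)
    finally have "z powr real (defect D \<pi> A B) < z powr t" using z by (simp add: powr_realpow)
    then show ?thesis using z by (meson powr_mono' less_le not_le)
  qed
  moreover have "real (card (collisions D m \<pi>)) < real (2 * D ^ 2)"
    using c1 D by (simp add: c_def field_simps)
  then have "card (collisions D m \<pi>) \<le> 2 * D ^ 2" by linarith
  moreover have "\<pi> i permutes {..<m}" if "i < D" for i using \<pi>(1) that by (auto simp: T_def)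
  ultimately show ?thesis by blast
qed

text \<open>A switching exchanges the partners of \<open>u\<close> and \<open>w\<close> in the
  matching \<open>i\<close>. With \<open>w\<close> outside at most \<open>2 * D\<close> bad
  positions it creates no new collision, and images of a set under the old and the new matching
  differ in at most two points.\<close>

lemma remove_collision:
  assumes \<pi>: "\<And>i. i < D \<Longrightarrow> \<pi> i permutes {..<m}" and m: "2 * D < m"
    and ne: "collisions D m \<pi> \<noteq> {}"
  shows "\<exists>\<pi>'. (\<forall>i<D. \<pi>' i permutes {..<m}) \<and> card (collisions D m \<pi>') < card (collisions D m \<pi>) \<and>
    (\<forall>A B. finite A \<longrightarrow> finite B \<longrightarrow> defect D \<pi> A B \<le> defect D \<pi>' A B + 2)"
proof -
  obtain i j u where iju: "i < D" "j < D" "i \<noteq> j" "u < m" "\<pi> i u = \<pi> j u"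
    using ne by (auto simp: collisions_def)
  \<comment> \<open>The first family would cause a collision at \<open>u\<close> after the exchange,
    the second one at \<open>w\<close>; the case \<open>k = i\<close> also rules out
    \<open>w = u\<close>.\<close>
  define bad where "bad = (\<lambda>k. inv_into UNIV (\<pi> i) (\<pi> k u)) ` {..<D} \<union> (\<lambda>k. inv_into UNIV (\<pi> k) (\<pi> i u)) ` {..<D}"
  have im: "card (h ` {..<D}) \<le> D" for h :: "nat \<Rightarrow> nat"
    using card_image_le[of "{..<D}" h] by simp
  have "card bad \<le> D + D"
    unfolding bad_def by (rule order.trans[OF card_Un_le add_mono[OF im im]])
  then have "\<not> {..<m} \<subseteq> bad"
    using m card_mono[of bad "{..<m}"] by (auto simp: bad_def)
  then obtain w where w: "w < m" "w \<notin> bad" by auto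
  have w1: "\<pi> i w \<noteq> \<pi> k u" if "k < D" for k
    using w(2) that permutes_inverses(2)[OF \<pi>[OF iju(1)], of w] by (auto simp: bad_def image_iff)
  have w2: "\<pi> k w \<noteq> \<pi> i u" if "k < D" for k
    using w(2) that permutes_inverses(2)[OF \<pi>[OF that], of w] by (auto simp: bad_def image_iff)
  define \<pi>' where "\<pi>' = \<pi>(i := \<pi> i \<circ> transpose u w)"
  have perm: "\<pi>' k permutes {..<m}" if "k < D" for k
    using that \<pi> iju w by (auto simp: \<pi>'_def intro!: permutes_compose permutes_swap_id)
  have sub: "collisions D m \<pi>' \<subseteq> collisions D m \<pi>"
  proof (clarsimp simp: collisions_def)
    fix a b x assume *: "a < D" "b < D" "a \<noteq> b" "x < m" "\<pi>' a x = \<pi>' b x"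
    show "\<pi> a x = \<pi> b x"
      using * w1[OF *(1)] w1[OF *(2)] w2[OF *(1)] w2[OF *(2)]
      by (auto simp: \<pi>'_def transpose_def split: if_splits)
  qed
  have "(i, j, u) \<in> collisions D m \<pi>" using iju by (auto simp: collisions_def)
  moreover have "(i, j, u) \<notin> collisions D m \<pi>'"
    using w1[OF iju(2)] iju by (auto simp: collisions_def \<pi>'_def)
  ultimately have less: "card (collisions D m \<pi>') < card (collisions D m \<pi>)"
    using sub by (intro psubset_card_mono) auto
  have "defect D \<pi> A B \<le> defect D \<pi>' A B + 2" if fin: "finite A" "finite B" for A B
  proof -
    have "sym_diff (\<pi> i ` A) B \<subseteq> sym_diff (\<pi>' i ` A) B \<union> {\<pi> i u, \<pi> i w}"
    proof -
      have "\<pi> i ` A - {\<pi> i u, \<pi> i w} = \<pi>' i ` A - {\<pi> i u, \<pi> i w}"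
        by (auto simp: \<pi>'_def image_iff transpose_def split: if_splits)
      then show ?thesis by blast
    qed
    then have "card (sym_diff (\<pi> i ` A) B) \<le> card (sym_diff (\<pi>' i ` A) B \<union> {\<pi> i u, \<pi> i w})"
      using fin by (intro card_mono) auto
    also have "\<dots> \<le> card (sym_diff (\<pi>' i ` A) B) + card {\<pi> i u, \<pi> i w}" by (rule card_Un_le)
    also have "\<dots> \<le> card (sym_diff (\<pi>' i ` A) B) + 2" by (simp add: card_insert_if)
    finally have "card (sym_diff (\<pi> i ` A) B) \<le> card (sym_diff (\<pi>' i ` A) B) + 2" .
    moreover have "(\<Sum>k\<in>{..<D} - {i}. card (sym_diff (\<pi> k ` A) B)) =
        (\<Sum>k\<in>{..<D} - {i}. card (sym_diff (\<pi>' k ` A) B))"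
      by (rule sum.cong) (auto simp: \<pi>'_def)
    ultimately show ?thesis
      using iju by (simp add: defect_def sum.remove[of "{..<D}" i])
  qed
  with perm less show ?thesis by blast
qed

lemma remove_collisions:
  assumes "\<And>i. i < D \<Longrightarrow> \<pi> i permutes {..<m}" and "2 * D < m"
  shows "\<exists>\<pi>'. (\<forall>i<D. \<pi>' i permutes {..<m}) \<and> collisions D m \<pi>' = {} \<and>
    (\<forall>A B. finite A \<longrightarrow> finite B \<longrightarrow>
      defect D \<pi> A B \<le> defect D \<pi>' A B + 2 * card (collisions D m \<pi>))"
  using assms
proof (induction "card (collisions D m \<pi>)" arbitrary: \<pi> rule: less_induct)
  case less
  show ?case
  proof (cases "collisions D m \<pi> = {}")
    case True
    then show ?thesis using less.prems by (intro exI[of _ \<pi>]) auto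
  next
    case False
    obtain \<sigma> where \<sigma>: "\<And>i. i < D \<Longrightarrow> \<sigma> i permutes {..<m}"
      "card (collisions D m \<sigma>) < card (collisions D m \<pi>)"
      "\<And>A B. finite A \<Longrightarrow> finite B \<Longrightarrow> defect D \<pi> A B \<le> defect D \<sigma> A B + 2"
      using remove_collision[OF less.prems False] by blast
    obtain \<pi>' where \<pi>': "\<And>i. i < D \<Longrightarrow> \<pi>' i permutes {..<m}" "collisions D m \<pi>' = {}"
      "\<And>A B. finite A \<Longrightarrow> finite B \<Longrightarrow>
        defect D \<sigma> A B \<le> defect D \<pi>' A B + 2 * card (collisions D m \<sigma>)"
      using less.hyps[OF \<sigma>(2,1) less.prems(2)] by blast
    have "defect D \<pi> A B \<le> defect D \<pi>' A B + 2 * card (collisions D m \<pi>)"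
      if "finite A" "finite B" for A B
      using \<sigma>(2) \<sigma>(3)[OF that] \<pi>'(3)[OF that] by linarith
    then show ?thesis using \<pi>'(1,2) by blast
  qed
qed

text \<open>The central coefficient is at least \<open>2 ^ m / (m + 1)\<close>. One step away from
  the centre loses at most a factor 2 as long as the size stays around \<open>m / 3\<close> or
  above, which is where \<open>\<epsilon> \<le> 1 / 6\<close> comes from. Sizes above the centre
  follow by symmetry.\<close>

lemma binomial_ge_near_middle:
  assumes \<epsilon>: "\<epsilon> \<le> 1 / 6" and a: "\<bar>real a - m / 2\<bar> \<le> \<epsilon> * m"
  shows "2 ^ m / (real m + 1) / 2 powr (\<epsilon> * m) \<le> real (m choose a)"
proof -
  have lower: "2 ^ m / (real m + 1) / 2 powr (\<epsilon> * m) \<le> real (m choose a)"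
    if a: "\<bar>real a - m / 2\<bar> \<le> \<epsilon> * m" and le: "a \<le> m div 2" for a
  proof -
    have "\<epsilon> * m \<le> 1 / 6 * m" using \<epsilon> by (intro mult_right_mono) auto
    then have a3: "m \<le> 3 * a + 2" using a by linarith
    have step: "m choose (a + k) \<le> 2 ^ k * (m choose a)" for k
    proof (induction k)
      case (Suc k)
      have "Suc (a + k) * (m choose Suc (a + k)) = (m - (a + k)) * (m choose (a + k))"
        by (simp only: binomial_absorption binomial_absorb_comp)
      also have "\<dots> \<le> (2 * Suc (a + k)) * (m choose (a + k))"
        using a3 by (intro mult_right_mono) auto
      finally have "m choose Suc (a + k) \<le> 2 * (m choose (a + k))"
        by (simp only: mult.assoc mult.left_commute[of 2] Suc_mult_le_cancel1)
      then show ?case using Suc by simp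
    qed simp
    have "(2 :: nat) ^ m = (\<Sum>k\<le>m. m choose k)" by (rule choose_row_sum[symmetric])
    also have "\<dots> \<le> (\<Sum>k\<le>m. m choose (m div 2))" by (intro sum_mono binomial_maximum)
    also have "\<dots> = (m + 1) * (m choose (m div 2))" by simp
    also have "\<dots> \<le> (m + 1) * (2 ^ (m div 2 - a) * (m choose a))"
      using step[of "m div 2 - a"] le by (intro mult_le_mono2) simp
    finally have "real (2 ^ m) \<le> real ((m + 1) * (2 ^ (m div 2 - a) * (m choose a)))"
      by (simp only: of_nat_le_iff)
    then have "2 ^ m \<le> real (m + 1) * (2 ^ (m div 2 - a) * real (m choose a))"
      by (simp only: of_nat_mult of_nat_power of_nat_numeral)
    also have "\<dots> \<le> real (m + 1) * (2 powr (\<epsilon> * m) * real (m choose a))"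
    proof (intro mult_left_mono mult_right_mono)
      show "(2 :: real) ^ (m div 2 - a) \<le> 2 powr (\<epsilon> * m)"
        using le a by (subst powr_realpow[symmetric]) (auto intro!: powr_mono)
    qed auto
    finally have "2 ^ m \<le> 2 powr (\<epsilon> * m) * real (m choose a) * real (m + 1)"
      by (simp only: mult.commute)
    then have "2 ^ m / real (m + 1) \<le> 2 powr (\<epsilon> * m) * real (m choose a)"
      by (subst pos_divide_le_eq) auto
    then have "2 ^ m / real (m + 1) \<le> real (m choose a) * 2 powr (\<epsilon> * m)"
      by (simp only: mult.commute)
    then show ?thesis by (subst pos_divide_le_eq) (auto simp: add.commute)
  qed
  show ?thesis
  proof (cases "a \<le> m div 2")
    case True
    then show ?thesis by (rule lower[OF a])
  next
    case False
    have "\<epsilon> * m \<le> 1 / 6 * m" using \<epsilon> by (intro mult_right_mono) auto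
    then have "a \<le> m" using a by linarith
    have "\<bar>real (m - a) - m / 2\<bar> \<le> \<epsilon> * m"
      using a \<open>a \<le> m\<close> by (simp only: of_nat_diff)
    then have "2 ^ m / (real m + 1) / 2 powr (\<epsilon> * m) \<le> real (m choose (m - a))"
      using False by (intro lower) auto
    then show ?thesis by (simp only: binomial_symmetric[OF \<open>a \<le> m\<close>])
  qed
qed

text \<open>The union bound ranges over at most \<open>4 ^ m\<close> pairs of sets, and \<open>((1 + z) * z powr (- f) / 2) ^ (D * m)\<close>
  is the Chernoff bound for one pair; \<open>z\<close> is chosen close to the minimiser \<open>f / (1 - f)\<close>.\<close>

lemma expansion_parameters:
  assumes "D \<ge> 3"
  shows "\<exists>(f :: real) (z :: real). 0 < z \<and> z < 1 \<and> (1 - 2 * sqrt (real D - 1) / D) / 6 < f \<and>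
    4 * ((1 + z) * z powr (- f) / 2) ^ D < 1"
proof (cases "D \<ge> 6")
  case True
  \<comment> \<open>Here \<open>f = 1 / 6\<close> exceeds \<open>c\<close> for every
    \<open>D\<close>, and \<open>z = 1 / 5\<close> is the exact minimiser. The bound
    \<open>q ^ 6 = 729 / 3125 < 1 / 4\<close> settles \<open>D \<ge> 6\<close>; for
    \<open>D = 5\<close> this \<open>f\<close> is too large, hence the case distinction.\<close>
  define q :: real where "q = (1 + 1 / 5) * (1 / 5) powr (- (1 / 6)) / 2"
  have q0: "q > 0" by (simp add: q_def)
  have "((1 / 5 :: real) powr (- (1 / 6))) ^ 6 = 5"
    by (simp add: powr_power powr_neg_one)
  then have q6: "q ^ 6 = 729 / 15625 * 5"
    unfolding q_def by (simp add: power_mult_distrib power_divide)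
  then have "q \<le> 1" using q0 using power_le_imp_le_base[of q 5 1] by simp
  then have "q ^ D \<le> q ^ 6" using True q0 by (intro power_decreasing) auto
  then have "4 * q ^ D < 1" using q6 by simp
  moreover have "(1 - 2 * sqrt (real D - 1) / D) / 6 < 1 / 6" using True by simp
  ultimately show ?thesis unfolding q_def by (intro exI[of _ "1/6"] exI[of _ "1/5"]) auto
next
  case False
  \<comment> \<open>For \<open>D \<le> 5\<close> the constant \<open>c\<close> is at most
    \<open>1 / 30\<close>, so \<open>f = 1 / 25\<close> suffices. The choice
    \<open>z = 1 / 20\<close> is close to the minimiser \<open>1 / 24\<close> and makes
    \<open>y ^ 25\<close> an integer. The exponential bound is tightest at
    \<open>D = 3\<close>.\<close>
  define y :: real where "y = (1 / 20) powr (- (1 / 25))"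
  have y0: "y > 0" by (simp add: y_def)
  have "y ^ 25 = 20" by (simp add: y_def powr_power powr_neg_one)
  moreover have "(y ^ 3) ^ 25 = (y ^ 25) ^ 3" by (simp flip: power_mult)
  ultimately have "(y ^ 3) ^ 25 \<le> (3 / 2) ^ 25" by (simp add: power_divide)
  then have y3: "y ^ 3 \<le> 3 / 2" using power_le_imp_le_base[of "y ^ 3" 24 "3/2"] by simp
  define q where "q = (1 + 1 / 20) * y / 2"
  have q0: "q > 0" using y0 by (simp add: q_def)
  have "q ^ 3 = 9261 / 64000 * y ^ 3" by (simp add: q_def power_mult_distrib power_divide)
  then have q3: "4 * q ^ 3 < 1" using y3 by simp
  then have "q \<le> 1" using q0 using power_le_imp_le_base[of q 2 1] by simp
  then have "q ^ D \<le> q ^ 3" using assms q0 by (intro power_decreasing) auto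
  then have "4 * q ^ D < 1" using q3 by simp
  moreover have "(1 - 2 * sqrt (real D - 1) / D) / 6 < 1 / 25"
  proof -
    have D: "D = 3 \<or> D = 4 \<or> D = 5" using assms False by linarith
    \<comment> \<open>The inequality \<open>c < 1 / 25\<close> solved for the square root.\<close>
    have "19 / 50 * D < sqrt (real D - 1)"
      using D by (intro real_less_rsqrt) (auto simp: power2_eq_square)
    then show ?thesis using assms by (simp add: field_simps)
  qed
  ultimately show ?thesis unfolding q_def y_def by (intro exI[of _ "1/25"] exI[of _ "1/20"]) auto
qed

lemma exists_expanding_matchings:
  assumes D: "D \<ge> 3"
  shows "\<exists>(f :: real) (\<epsilon> :: real). (1 - 2 * sqrt (real D - 1) / D) / 6 < f \<and> \<epsilon> > 0 \<and>
    (\<forall>\<^sub>F m in sequentially. \<exists>\<pi>. (\<forall>i<D. \<pi> i permutes {..<m}) \<and> collisions D m \<pi> = {} \<and>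
      (\<forall>A B. A \<subseteq> {..<m} \<longrightarrow> B \<subseteq> {..<m} \<longrightarrow> \<bar>real (card A) - m / 2\<bar> \<le> \<epsilon> * m \<longrightarrow>
        f * D * m \<le> real (defect D \<pi> A B)))"
proof -
  obtain f z :: real where z: "0 < z" "z < 1" and f: "(1 - 2 * sqrt (real D - 1) / D) / 6 < f"
    and q: "4 * ((1 + z) * z powr (- f) / 2) ^ D < 1"
    using expansion_parameters[OF D] by blast
  define q where "q = (1 + z) * z powr (- f) / 2"
  have q0: "q > 0" using z by (simp add: q_def)
  \<comment> \<open>Allowing sizes within \<open>\<epsilon> * m\<close> of \<open>m / 2\<close>
    costs a factor \<open>2 powr (\<epsilon> * m)\<close> per matching. By continuity at 0 some
    positive \<open>\<epsilon>\<close> keeps the base of the exponential bound below 1.\<close>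
  have "((\<lambda>\<epsilon>. 4 * (q * 2 powr \<epsilon>) ^ D) \<longlongrightarrow> 4 * (q * 2 powr 0) ^ D) (at_right 0)"
    by (intro tendsto_intros) auto
  then have "\<forall>\<^sub>F \<epsilon> in at_right 0. 4 * (q * 2 powr \<epsilon>) ^ D < 1"
    using assms(1) \<open>4 * _ ^ D < 1\<close> by (intro order_tendstoD(2)) (auto simp: q_def)
  moreover have "\<forall>\<^sub>F \<epsilon> :: real in at_right 0. 0 < \<epsilon> \<and> \<epsilon> < 1 / 6"
    by (auto simp: eventually_at_right_field intro!: exI[of _ "1/6"])
  ultimately have "\<forall>\<^sub>F \<epsilon> in at_right 0. 4 * (q * 2 powr \<epsilon>) ^ D < 1 \<and> 0 < \<epsilon> \<and> \<epsilon> < 1 / 6"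
    by eventually_elim auto
  then obtain \<epsilon> where \<epsilon>: "4 * (q * 2 powr \<epsilon>) ^ D < 1" "0 < \<epsilon>" "\<epsilon> < 1 / 6"
    using eventually_happens'[OF trivial_limit_at_right_real] by blast
  define r where "r = 4 * (q * 2 powr \<epsilon>) ^ D"
  have r: "0 < r" "r < 1" using \<epsilon> q0 by (auto simp: r_def)
  define c where "c = (1 - 2 * sqrt (real D - 1) / D) / 6"
  \<comment> \<open>The midpoint leaves \<open>f - f'\<close> to absorb the \<open>4 * D ^ 2\<close>
    by which removing at most \<open>2 * D ^ 2\<close> collisions can lower a defect.\<close>
  define f' where "f' = (c + f) / 2"
  have "c < f" using f by (simp add: c_def)
  then have f': "c < f'" "f' < f" by (simp_all add: f'_def)
  \<comment> \<open>The polynomial factor stems from the bound \<open>2 ^ m / (m + 1)\<close> on the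
    central binomial coefficient, used once per matching.\<close>
  have "(\<lambda>m. (real m + 1) ^ D * r ^ m) \<longlonglongrightarrow> 0" using r by real_asymp
  then have "\<forall>\<^sub>F m in sequentially. (real m + 1) ^ D * r ^ m < 1 / 2"
    by (rule order_tendstoD) simp
  moreover have "\<forall>\<^sub>F m in sequentially. (f - f') * D * real m \<ge> 4 * D ^ 2"
  proof -
    have "filterlim (\<lambda>m. (f - f') * D * real m) at_top sequentially"
      using f' D by (intro filterlim_tendsto_pos_mult_at_top[OF tendsto_const] filterlim_real_sequentially) auto
    then show ?thesis by (simp add: filterlim_at_top)
  qed
  moreover have "\<forall>\<^sub>F m in sequentially. m > 2 * D" by (rule eventually_gt_at_top)
  ultimately have "\<forall>\<^sub>F m in sequentially. \<exists>\<pi>. (\<forall>i<D. \<pi> i permutes {..<m}) \<and> collisions D m \<pi> = {} \<and>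
      (\<forall>A B. A \<subseteq> {..<m} \<longrightarrow> B \<subseteq> {..<m} \<longrightarrow> \<bar>real (card A) - m / 2\<bar> \<le> \<epsilon> * m \<longrightarrow>
        f' * D * m \<le> real (defect D \<pi> A B))"
  proof eventually_elim
    case (elim m)
    define \<A> where "\<A> = {A. A \<subseteq> {..<m} \<and> \<bar>real (card A) - m / 2\<bar> \<le> \<epsilon> * m}"
    define K where "K = 2 ^ m / (real m + 1) / 2 powr (\<epsilon> * m)"
    have K: "K > 0" by (simp add: K_def)
    have small: "4 ^ m * ((1 + z) ^ m / K) ^ D < z powr (f * D * m) / 2"
    proof -
      have "(1 + z) ^ m / K = (real m + 1) * ((1 + z) / 2 * 2 powr \<epsilon>) ^ m"
        by (simp add: K_def power_mult_distrib power_divide powr_power mult.commute[of \<epsilon>])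
      also have "(1 + z) / 2 * 2 powr \<epsilon> = q * 2 powr \<epsilon> * z powr f"
        using z by (simp add: q_def powr_minus)
      finally have "4 ^ m * ((1 + z) ^ m / K) ^ D =
          4 ^ m * ((real m + 1) * (q * 2 powr \<epsilon> * z powr f) ^ m) ^ D" by simp
      also have "\<dots> = (real m + 1) ^ D * r ^ m * ((z powr f) ^ m) ^ D"
        by (simp add: r_def power_mult_distrib) (simp add: mult.commute flip: power_mult)
      also have "((z powr f) ^ m) ^ D = z powr (f * D * m)"
        using z by (simp add: powr_power flip: power_mult) (simp add: mult_ac)
      also have "(real m + 1) ^ D * r ^ m * z powr (f * D * m) < 1 / 2 * z powr (f * D * m)"
        using elim(1) z by (intro mult_strict_right_mono) auto
      finally show ?thesis by simp
    qed
    have "A \<subseteq> {..<m} \<and> K \<le> real (m choose card A)" if "A \<in> \<A>" for A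
      using that binomial_ge_near_middle[of \<epsilon> "card A" m] \<epsilon> by (auto simp: \<A>_def K_def add.commute)
    then obtain \<pi> where \<pi>: "\<And>i. i < D \<Longrightarrow> \<pi> i permutes {..<m}" "card (collisions D m \<pi>) \<le> 2 * D ^ 2"
      "\<And>A B. A \<in> \<A> \<Longrightarrow> B \<subseteq> {..<m} \<Longrightarrow> f * D * m \<le> real (defect D \<pi> A B)"
      using exists_matchings_few_collisions[OF z K _ _ small] D by (metis gr0I not_numeral_le_zero)
    obtain \<pi>' where \<pi>': "\<And>i. i < D \<Longrightarrow> \<pi>' i permutes {..<m}" "collisions D m \<pi>' = {}"
      "\<And>A B. finite A \<Longrightarrow> finite B \<Longrightarrow>
        defect D \<pi> A B \<le> defect D \<pi>' A B + 2 * card (collisions D m \<pi>)"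
      using remove_collisions[of D \<pi> m, OF \<pi>(1) elim(3)] by blast
    have "f' * D * m \<le> real (defect D \<pi>' A B)"
      if AB: "A \<subseteq> {..<m}" "B \<subseteq> {..<m}" "\<bar>real (card A) - m / 2\<bar> \<le> \<epsilon> * m" for A B
    proof -
      have "finite A" "finite B" using AB finite_subset by blast+
      then have "defect D \<pi> A B \<le> defect D \<pi>' A B + 4 * D ^ 2"
        using \<pi>'(3)[of A B] \<pi>(2) by linarith
      then have "real (defect D \<pi> A B) \<le> real (defect D \<pi>' A B + 4 * D ^ 2)" by (rule of_nat_mono)
      moreover have "f * D * m \<le> real (defect D \<pi> A B)" using AB by (intro \<pi>(3)) (auto simp: \<A>_def)
      ultimately show ?thesis using elim(2) by (simp add: algebra_simps)
    qed
    then show ?case using \<pi>'(1,2) by blast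
  qed
  then show ?thesis using f' \<epsilon>(2) by (intro exI[of _ f'] exI[of _ \<epsilon>]) (auto simp: c_def)
qed

subsection \<open>Operators on qubit states\<close>

text \<open>The basis state \<open>A\<close> has exactly the qubits in \<open>A\<close> equal to \<open>1\<close>. Qubits beyond \<open>n\<close> are allowed
  here, so operators are plain functions without carrier conditions.\<close>

type_synonym state = "nat set \<Rightarrow> complex"

definition flip :: "nat \<Rightarrow> nat set \<Rightarrow> nat set" where
  "flip u A = (if u \<in> A then A - {u} else insert u A)"

definition sgn_bit :: "nat set \<Rightarrow> nat \<Rightarrow> real" where
  "sgn_bit A u = (if u \<in> A then - 1 else 1)"

definition opX :: "nat \<Rightarrow> state \<Rightarrow> state" where
  "opX u \<psi> A = \<psi> (flip u A)"

definition opD :: "(nat set \<Rightarrow> complex) \<Rightarrow> state \<Rightarrow> state" where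
  "opD f \<psi> A = f A * \<psi> A"

definition opZ :: "nat \<Rightarrow> state \<Rightarrow> state" where
  "opZ u = opD (\<lambda>A. complex_of_real (sgn_bit A u))"

text \<open>This is \<open>exp (\<i> b X\<^sub>u)\<close>, since \<open>X\<^sub>u\<close> squares to
  the identity.\<close>

definition rotX :: "real \<Rightarrow> nat \<Rightarrow> state \<Rightarrow> state" where
  "rotX b u \<psi> A = complex_of_real (cos b) * \<psi> A + \<i> * complex_of_real (sin b) * \<psi> (flip u A)"

primrec mixer_op :: "real \<Rightarrow> nat \<Rightarrow> state \<Rightarrow> state" where
  "mixer_op b 0 = id"
| "mixer_op b (Suc n) = rotX b n \<circ> mixer_op b n"

text \<open>The Ising Hamiltonian is diagonal, and this is its eigenvalue at the basis state
  \<open>A\<close>; \<open>phase_op c E\<close> is the exponential of \<open>\<i> * c\<close> times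
  it.\<close>

definition cut_size :: "nat set set \<Rightarrow> nat set \<Rightarrow> real" where
  "cut_size E A = (\<Sum>e\<in>E. (1 - sgn_bit A (Min e) * sgn_bit A (Max e)) / 2)"

definition phase_op :: "real \<Rightarrow> nat set set \<Rightarrow> state \<Rightarrow> state" where
  "phase_op c E = opD (\<lambda>A. cis (c * cut_size E A))"

definition linear_op :: "(state \<Rightarrow> state) \<Rightarrow> bool" where
  "linear_op O1 \<longleftrightarrow> (\<forall>a b \<phi> \<psi>. O1 (\<lambda>A. a * \<phi> A + b * \<psi> A) = (\<lambda>A. a * O1 \<phi> A + b * O1 \<psi> A))"

lemma linear_opD: "linear_op O1 \<Longrightarrow> O1 (\<lambda>A. a * \<phi> A + b * \<psi> A) = (\<lambda>A. a * O1 \<phi> A + b * O1 \<psi> A)"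
  by (simp add: linear_op_def)

lemma linear_op_scale:
  assumes "linear_op O1" shows "O1 (\<lambda>A. a * \<phi> A) = (\<lambda>A. a * O1 \<phi> A)"
  using linear_opD[OF assms, of a \<phi> 0 \<phi>] by simp

section \<open>Elementary gates: linearity and inverses\<close>

lemma flip_flip [simp]: "flip u (flip u A) = A"
  by (auto simp: flip_def)

lemma flip_commute: "flip u (flip v A) = flip v (flip u A)"
  by (auto simp: flip_def)

lemma mem_flip: "v \<in> flip u A \<longleftrightarrow> (if v = u then v \<notin> A else v \<in> A)"
  by (auto simp: flip_def)

lemma sgn_bit_flip: "sgn_bit (flip u A) v = (if v = u then - sgn_bit A v else sgn_bit A v)"
  by (simp add: sgn_bit_def mem_flip)

lemma sgn_bit_cases: "sgn_bit A u = 1 \<or> sgn_bit A u = - 1"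
  by (simp add: sgn_bit_def)

lemma linear_op_id [simp]: "linear_op id" and linear_op_opX [simp]: "linear_op (opX u)"
  and linear_op_opD [simp]: "linear_op (opD f)" and linear_op_opZ [simp]: "linear_op (opZ u)"
  and linear_op_rotX [simp]: "linear_op (rotX b u)"
  by (auto simp: linear_op_def opX_def opD_def opZ_def rotX_def algebra_simps)

lemma linear_op_comp [intro]: "linear_op O1 \<Longrightarrow> linear_op O2 \<Longrightarrow> linear_op (O1 \<circ> O2)"
  by (simp add: linear_op_def)

lemma linear_op_mixer [simp]: "linear_op (mixer_op b n)"
  by (induction n) (auto simp del: comp_apply id_apply intro: linear_op_comp)

lemma linear_op_phase [simp]: "linear_op (phase_op c E)"
  by (simp add: phase_op_def)

lemma opX_invol [simp]: "opX u (opX u \<psi>) = \<psi>"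
  by (auto simp: opX_def)

lemma rotX_minus [simp]: "rotX (- b) u (rotX b u \<psi>) = \<psi>"
proof
  fix A
  have "complex_of_real (cos b) * cos b + complex_of_real (sin b) * sin b = 1"
    using sin_cos_squared_add3[of b] by (metis add.commute of_real_1 of_real_add of_real_mult)
  moreover have "rotX (- b) u (rotX b u \<psi>) A =
      (complex_of_real (cos b) * cos b + complex_of_real (sin b) * sin b) * \<psi> A"
    by (simp add: rotX_def algebra_simps)
  ultimately show "rotX (- b) u (rotX b u \<psi>) A = \<psi> A" by simp
qed

text \<open>Locality is expressed by commutation: \<open>X\<close> and \<open>Z\<close> generate all
  operators on a qubit, so commuting with both at \<open>w\<close> means acting trivially there.
  This form suits conjugation by gates and avoids tensor decompositions.\<close>

definition supported :: "nat set \<Rightarrow> (state \<Rightarrow> state) \<Rightarrow> bool" where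
  "supported T O1 \<longleftrightarrow> linear_op O1 \<and>
     (\<forall>w. w \<notin> T \<longrightarrow> O1 \<circ> opX w = opX w \<circ> O1 \<and> O1 \<circ> opZ w = opZ w \<circ> O1)"

lemma supported_opZ: "supported {u} (opZ u)"
  by (auto simp: supported_def opZ_def opD_def opX_def fun_eq_iff sgn_bit_flip)

lemma rotX_comm_opX: "rotX b u \<circ> opX w = opX w \<circ> rotX b u"
  by (auto simp: rotX_def opX_def fun_eq_iff flip_commute)

lemma rotX_comm_opZ: "u \<noteq> w \<Longrightarrow> rotX b u \<circ> opZ w = opZ w \<circ> rotX b u"
  by (auto simp: rotX_def opZ_def opD_def fun_eq_iff sgn_bit_flip algebra_simps)

lemma comm_rotX:
  assumes "linear_op O1" "O1 \<circ> opX u = opX u \<circ> O1"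
  shows "O1 \<circ> rotX b u = rotX b u \<circ> O1"
proof
  fix \<psi>
  have eq: "rotX b u \<psi> = (\<lambda>A. complex_of_real (cos b) * \<psi> A + (\<i> * complex_of_real (sin b)) * opX u \<psi> A)" for \<psi>
    by (auto simp: rotX_def opX_def)
  have "O1 (opX u \<psi>) = opX u (O1 \<psi>)" using assms(2) by (metis comp_apply)
  then show "(O1 \<circ> rotX b u) \<psi> = (rotX b u \<circ> O1) \<psi>"
    unfolding comp_apply eq linear_opD[OF assms(1)] by simp
qed

lemma comm_conj:
  assumes "R \<circ> X = X \<circ> R" "R' \<circ> X = X \<circ> R'" "O1 \<circ> X = X \<circ> O1"
  shows "(R' \<circ> O1 \<circ> R) \<circ> X = X \<circ> (R' \<circ> O1 \<circ> R)"
proof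
  fix \<psi>
  show "((R' \<circ> O1 \<circ> R) \<circ> X) \<psi> = (X \<circ> (R' \<circ> O1 \<circ> R)) \<psi>"
    using fun_cong[OF assms(1), of \<psi>] fun_cong[OF assms(3), of "R \<psi>"]
      fun_cong[OF assms(2), of "O1 (R \<psi>)"] by (simp only: comp_apply)
qed

lemma comm_comp:
  assumes "X \<circ> P = P \<circ> X" "X \<circ> Q = Q \<circ> X"
  shows "X \<circ> (P \<circ> Q) = (P \<circ> Q) \<circ> X"
proof
  fix \<psi>
  show "(X \<circ> (P \<circ> Q)) \<psi> = ((P \<circ> Q) \<circ> X) \<psi>"
    using fun_cong[OF assms(1), of "Q \<psi>"] fun_cong[OF assms(2), of \<psi>] by (simp only: comp_apply)
qed

text \<open>The mixer does not enlarge supports: a rotation outside \<open>T\<close> commutes with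
  \<open>O1\<close> and cancels against its inverse, and one inside \<open>T\<close> commutes with
  all Pauli operators outside.\<close>

lemma supported_conj_rotX:
  assumes "supported T O1"
  shows "supported T (rotX (- b) u \<circ> O1 \<circ> rotX b u)"
proof (cases "u \<in> T")
  case True
  then show ?thesis using assms
    by (auto simp: supported_def intro!: linear_op_comp comm_conj rotX_comm_opX rotX_comm_opZ)
next
  case False
  then have "O1 \<circ> rotX b u = rotX b u \<circ> O1"
    using assms by (intro comm_rotX) (auto simp: supported_def)
  then have "rotX (- b) u \<circ> O1 \<circ> rotX b u = rotX (- b) u \<circ> (rotX b u \<circ> O1)"
    by (simp only: comp_assoc)
  also have "\<dots> = O1" by (auto simp: fun_eq_iff)
  finally have "rotX (- b) u \<circ> O1 \<circ> rotX b u = O1" .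
  then show ?thesis using assms by simp
qed

text \<open>Both \<open>mixer_op b\<close> and \<open>mixer_op (- b)\<close> apply the rotations in the order \<open>0, 1, \<dots>\<close>, so they
  are inverse to each other only because the rotations commute.\<close>

lemma rotX_comm_mixer: "rotX b u \<circ> mixer_op c n = mixer_op c n \<circ> rotX b u"
proof (induction n)
  case (Suc n)
  have "rotX b u \<circ> rotX c n = rotX c n \<circ> rotX b u"
    by (rule comm_rotX) (auto simp: rotX_comm_opX)
  then show ?case using comm_comp Suc by (simp only: mixer_op.simps(2))
qed simp

lemma mixer_op_Suc': "mixer_op b (Suc n) = mixer_op b n \<circ> rotX b n"
  by (simp add: rotX_comm_mixer)

lemma mixer_op_minus: "mixer_op (- b) n \<circ> mixer_op b n = id"
proof (induction n)
  case (Suc n)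
  have "mixer_op (- b) (Suc n) \<circ> mixer_op b (Suc n) =
      mixer_op (- b) n \<circ> (rotX (- b) n \<circ> rotX b n) \<circ> mixer_op b n"
    by (simp only: mixer_op_Suc'[of "- b"] mixer_op.simps(2)[of b] comp_assoc)
  also have "rotX (- b) n \<circ> rotX b n = id" by auto
  finally show ?case using Suc by simp
qed simp

lemma supported_conj_mixer:
  assumes "supported T O1"
  shows "supported T (mixer_op (- b) n \<circ> O1 \<circ> mixer_op b n)"
proof (induction n)
  case (Suc n)
  have "mixer_op (- b) (Suc n) \<circ> O1 \<circ> mixer_op b (Suc n) =
      rotX (- b) n \<circ> (mixer_op (- b) n \<circ> O1 \<circ> mixer_op b n) \<circ> rotX b n"
    by (simp only: mixer_op_Suc'[of b] mixer_op.simps(2)[of "- b"] comp_assoc)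
  then show ?case using supported_conj_rotX[OF Suc] by metis
qed (simp add: assms)

section \<open>Growth of supports under the phase layer\<close>

definition neighbourhood :: "nat set set \<Rightarrow> nat set \<Rightarrow> nat set" where
  "neighbourhood E T = T \<union> \<Union>{e \<in> E. e \<inter> T \<noteq> {}}"

lemma opD_comm: "opD f \<circ> opD g = opD g \<circ> opD f"
  by (auto simp: opD_def fun_eq_iff)

lemma opD_comp: "opD f \<circ> opD g = opD (\<lambda>A. f A * g A)"
  by (auto simp: opD_def fun_eq_iff)

text \<open>A product of two signs is \<open>1\<close> or \<open>- 1\<close>, so the phase of an
  edge is affine in \<open>Z\<^sub>u Z\<^sub>v\<close>. Commuting with \<open>opZ u\<close> and
  \<open>opZ v\<close> therefore implies commuting with the edge phase.\<close>

lemma cis_edge: "cis (c * ((1 - sgn_bit A u * sgn_bit A v) / 2)) =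
    (1 + cis c) / 2 + (1 - cis c) / 2 * (sgn_bit A u * sgn_bit A v)"
  using sgn_bit_cases[of A u] sgn_bit_cases[of A v] by (auto simp: field_simps)

lemma phase_op_insert:
  assumes "finite E" "e \<notin> E"
  shows "phase_op c (insert e E) = opD (\<lambda>A. cis (c * ((1 - sgn_bit A (Min e) * sgn_bit A (Max e)) / 2))) \<circ> phase_op c E"
  using assms by (simp add: phase_op_def opD_comp cut_size_def cis_mult distrib_left)

lemma phase_op_Un:
  assumes "finite E" "finite F" "E \<inter> F = {}"
  shows "phase_op c (E \<union> F) = phase_op c E \<circ> phase_op c F"
  using assms by (simp add: phase_op_def opD_comp cut_size_def sum.union_disjoint cis_mult distrib_left)

lemma phase_op_minus: "phase_op (- c) E \<circ> phase_op c E = id"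
  by (auto simp: phase_op_def opD_def fun_eq_iff cis_mult simp flip: mult.assoc)

lemma comm_edge_phase:
  fixes c :: real
  assumes O1: "linear_op O1" "O1 \<circ> opZ u = opZ u \<circ> O1" "O1 \<circ> opZ v = opZ v \<circ> O1"
  defines "P \<equiv> opD (\<lambda>A. cis (c * ((1 - sgn_bit A u * sgn_bit A v) / 2)))"
  shows "O1 \<circ> P = P \<circ> O1"
proof
  fix \<psi>
  have eq: "P \<psi> = (\<lambda>A. (1 + cis c) / 2 * \<psi> A + (1 - cis c) / 2 * opZ u (opZ v \<psi>) A)" for \<psi>
    unfolding P_def opZ_def cis_edge by (auto simp: opD_def algebra_simps)
  have "O1 (opZ u (opZ v \<psi>)) = opZ u (opZ v (O1 \<psi>))" using O1(2,3) by (metis comp_apply)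
  then show "(O1 \<circ> P) \<psi> = (P \<circ> O1) \<psi>" unfolding comp_apply eq linear_opD[OF O1(1)] by simp
qed

lemma comm_phase_op:
  assumes O1: "supported T O1" and E: "finite E" "\<And>e. e \<in> E \<Longrightarrow> Min e \<notin> T \<and> Max e \<notin> T"
  shows "O1 \<circ> phase_op c E = phase_op c E \<circ> O1"
  using E
proof (induction E)
  case empty
  have "phase_op c {} = id" by (auto simp: phase_op_def opD_def cut_size_def fun_eq_iff)
  then show ?case by simp
next
  case (insert e E)
  define P where "P = opD (\<lambda>A. cis (c * ((1 - sgn_bit A (Min e) * sgn_bit A (Max e)) / 2)))"
  have "O1 \<circ> P = P \<circ> O1"
    unfolding P_def using O1 insert.prems[of e] by (intro comm_edge_phase) (auto simp: supported_def)
  moreover have "O1 \<circ> phase_op c E = phase_op c E \<circ> O1" using insert by blast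
  ultimately show ?case
    unfolding phase_op_insert[OF insert(1,2)] P_def[symmetric] by (rule comm_comp)
qed

lemma cut_flip:
  assumes "\<And>e. e \<in> E \<Longrightarrow> Min e \<noteq> w \<and> Max e \<noteq> w"
  shows "cut_size E (flip w A) = cut_size E A"
  unfolding cut_size_def by (rule sum.cong) (use assms in \<open>auto simp: sgn_bit_flip\<close>)

lemma phase_op_comm_opX:
  assumes "\<And>e. e \<in> E \<Longrightarrow> Min e \<noteq> w \<and> Max e \<noteq> w"
  shows "phase_op c E \<circ> opX w = opX w \<circ> phase_op c E"
  by (auto simp: phase_op_def opD_def opX_def fun_eq_iff cut_flip[OF assms])

lemma phase_op_comm_opZ: "phase_op c E \<circ> opZ w = opZ w \<circ> phase_op c E"
  by (simp add: phase_op_def opZ_def opD_comm)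

text \<open>All phases commute with each other, and those of edges missing \<open>T\<close> also
  commute with \<open>O1\<close>, so they cancel in the conjugation. The remaining edges lie within
  the neighbourhood.\<close>

lemma supported_conj_phase:
  assumes O1: "supported T O1" and E: "finite E" "\<And>e. e \<in> E \<Longrightarrow> finite e \<and> e \<noteq> {}"
  shows "supported (neighbourhood E T) (phase_op (- c) E \<circ> O1 \<circ> phase_op c E)"
proof -
  have mem: "Min e \<in> e \<and> Max e \<in> e" if "e \<in> E" for e using E(2)[OF that] by simp
  define F where "F = {e \<in> E. e \<inter> T \<noteq> {}}"
  define G where "G = E - F"
  have split: "E = F \<union> G" "F \<inter> G = {}" "finite F" "finite G" using E by (auto simp: F_def G_def)
  have comm: "O1 \<circ> phase_op c G = phase_op c G \<circ> O1"
    using mem split(4) by (intro comm_phase_op[OF O1]) (auto simp: F_def G_def)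
  have "phase_op (- c) E \<circ> O1 \<circ> phase_op c E =
      phase_op (- c) F \<circ> (phase_op (- c) G \<circ> phase_op c G) \<circ> O1 \<circ> phase_op c F"
  proof -
    have "phase_op c E = phase_op c G \<circ> phase_op c F"
      using split phase_op_Un[of G F] by (simp add: Int_commute Un_commute)
    moreover have "phase_op (- c) E = phase_op (- c) F \<circ> phase_op (- c) G"
      using split phase_op_Un[of F G] by simp
    ultimately have "phase_op (- c) E \<circ> O1 \<circ> phase_op c E =
        phase_op (- c) F \<circ> (phase_op (- c) G \<circ> (O1 \<circ> phase_op c G) \<circ> phase_op c F)"
      by (simp only: comp_assoc)
    then show ?thesis unfolding comm by (simp only: comp_assoc)
  qed
  also have "\<dots> = phase_op (- c) F \<circ> O1 \<circ> phase_op c F" by (simp add: phase_op_minus)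
  finally have eq: "phase_op (- c) E \<circ> O1 \<circ> phase_op c E = phase_op (- c) F \<circ> O1 \<circ> phase_op c F" .
  show ?thesis unfolding eq supported_def
  proof (intro conjI allI impI)
    show "linear_op (phase_op (- c) F \<circ> O1 \<circ> phase_op c F)"
      using O1 by (auto simp: supported_def intro!: linear_op_comp)
    fix w assume w: "w \<notin> neighbourhood E T"
    have wF: "Min e \<noteq> w \<and> Max e \<noteq> w" if "e \<in> F" for e
      using w mem[of e] that by (auto simp: neighbourhood_def F_def)
    have O1w: "O1 \<circ> opX w = opX w \<circ> O1" "O1 \<circ> opZ w = opZ w \<circ> O1"
      using O1 w by (auto simp: supported_def neighbourhood_def)
    show "phase_op (- c) F \<circ> O1 \<circ> phase_op c F \<circ> opX w = opX w \<circ> (phase_op (- c) F \<circ> O1 \<circ> phase_op c F)"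
      by (intro comm_conj phase_op_comm_opX O1w wF)
    show "phase_op (- c) F \<circ> O1 \<circ> phase_op c F \<circ> opZ w = opZ w \<circ> (phase_op (- c) F \<circ> O1 \<circ> phase_op c F)"
      by (intro comm_conj phase_op_comm_opZ O1w)
  qed
qed

subsection \<open>QAOA in the Heisenberg picture\<close>

definition flips :: "nat set \<Rightarrow> state \<Rightarrow> state" where
  "flips S \<psi> A = \<psi> (sym_diff A S)"

lemma flips_insert: "u \<notin> S \<Longrightarrow> flips (insert u S) = opX u \<circ> flips S"
  by (intro ext) (auto simp: flips_def opX_def flip_def intro!: arg_cong[of _ _ "_ :: state"])

lemma flips_comp: "S \<inter> T = {} \<Longrightarrow> flips S \<circ> flips T = flips (S \<union> T)"
  by (intro ext) (auto simp: flips_def intro!: arg_cong[of _ _ "_ :: state"])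

lemma flips_invol: "flips S \<circ> flips S = id"
  by (intro ext) (auto simp: flips_def intro!: arg_cong[of _ _ "_ :: state"])

lemma comm_flips:
  assumes "finite S" "\<And>u. u \<in> S \<Longrightarrow> O1 \<circ> opX u = opX u \<circ> O1"
  shows "O1 \<circ> flips S = flips S \<circ> O1"
  using assms
proof (induction S)
  case empty
  have "flips {} = id" by (auto simp: flips_def fun_eq_iff)
  then show ?case by simp
next
  case (insert u S)
  show ?case unfolding flips_insert[OF insert(2)]
    by (intro comm_comp insert.IH insert.prems) auto
qed

lemma mixer_comm_flips:
  assumes "finite S" shows "mixer_op b n \<circ> flips S = flips S \<circ> mixer_op b n"
proof (induction n)
  case (Suc n)
  have "rotX b n \<circ> flips S = flips S \<circ> rotX b n"
    by (rule comm_flips[OF assms]) (rule rotX_comm_opX)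
  then show ?case using comm_comp[OF _ Suc[symmetric]] by (simp only: mixer_op.simps(2))
qed simp

lemma cut_flips:
  assumes "\<And>e. e \<in> E \<Longrightarrow> Min e \<in> S \<and> Max e \<in> S"
  shows "cut_size E (sym_diff A S) = cut_size E A"
  unfolding cut_size_def by (rule sum.cong) (use assms in \<open>auto simp: sgn_bit_def\<close>)

lemma phase_comm_flips:
  assumes "\<And>e. e \<in> E \<Longrightarrow> Min e \<in> S \<and> Max e \<in> S"
  shows "phase_op c E \<circ> flips S = flips S \<circ> phase_op c E"
  by (intro ext) (simp add: phase_op_def opD_def flips_def cut_flips[OF assms])

primrec circuit_op :: "nat \<Rightarrow> nat set set \<Rightarrow> nat \<Rightarrow> (nat \<Rightarrow> real) \<Rightarrow> (nat \<Rightarrow> real) \<Rightarrow> state \<Rightarrow> state" where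
  "circuit_op n E 0 \<beta> \<gamma> = id"
| "circuit_op n E (Suc p) \<beta> \<gamma> =
     circuit_op n E p \<beta> \<gamma> \<circ> (mixer_op (\<beta> (Suc p)) n \<circ> phase_op (\<gamma> (Suc p)) E)"

text \<open>Negated angles in reverse order: with the inverse given explicitly, invertibility and
  adjointness become simple inductions.\<close>

primrec circuit_inv :: "nat \<Rightarrow> nat set set \<Rightarrow> nat \<Rightarrow> (nat \<Rightarrow> real) \<Rightarrow> (nat \<Rightarrow> real) \<Rightarrow> state \<Rightarrow> state" where
  "circuit_inv n E 0 \<beta> \<gamma> = id"
| "circuit_inv n E (Suc p) \<beta> \<gamma> =
     (phase_op (- \<gamma> (Suc p)) E \<circ> mixer_op (- \<beta> (Suc p)) n) \<circ> circuit_inv n E p \<beta> \<gamma>"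

lemma phase_op_cancel [simp]:
  "phase_op (- c) E (phase_op c E \<psi>) = \<psi>" "phase_op c E (phase_op (- c) E \<psi>) = \<psi>"
  using fun_cong[OF phase_op_minus, of c E \<psi>] fun_cong[OF phase_op_minus, of "- c" E \<psi>] by simp_all

lemma mixer_op_cancel [simp]:
  "mixer_op (- b) n (mixer_op b n \<psi>) = \<psi>" "mixer_op b n (mixer_op (- b) n \<psi>) = \<psi>"
  using fun_cong[OF mixer_op_minus, of b n \<psi>] fun_cong[OF mixer_op_minus, of "- b" n \<psi>] by simp_all

lemma circuit_op_inv [simp]: "circuit_op n E p \<beta> \<gamma> (circuit_inv n E p \<beta> \<gamma> \<psi>) = \<psi>"
  by (induction p arbitrary: \<psi>) simp_all

lemma circuit_inv_op [simp]: "circuit_inv n E p \<beta> \<gamma> (circuit_op n E p \<beta> \<gamma> \<psi>) = \<psi>"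
  by (induction p arbitrary: \<psi>) simp_all

definition heisenberg ::
  "nat \<Rightarrow> nat set set \<Rightarrow> nat \<Rightarrow> (nat \<Rightarrow> real) \<Rightarrow> (nat \<Rightarrow> real) \<Rightarrow> (state \<Rightarrow> state) \<Rightarrow> state \<Rightarrow> state" where
  "heisenberg n E p \<beta> \<gamma> O1 = circuit_inv n E p \<beta> \<gamma> \<circ> O1 \<circ> circuit_op n E p \<beta> \<gamma>"

text \<open>The factor with the largest index acts on the state first, so it conjugates outermost.
  Induction on \<open>p\<close> thus wraps one more layer around the evolved operator.\<close>

lemma heisenberg_Suc: "heisenberg n E (Suc p) \<beta> \<gamma> O1 =
    phase_op (- \<gamma> (Suc p)) E \<circ> (mixer_op (- \<beta> (Suc p)) n \<circ> heisenberg n E p \<beta> \<gamma> O1 \<circ>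
      mixer_op (\<beta> (Suc p)) n) \<circ> phase_op (\<gamma> (Suc p)) E"
  by (simp only: heisenberg_def circuit_op.simps circuit_inv.simps comp_assoc)

section \<open>Light cones and parity of evolved \<open>Z\<close> operators\<close>

primrec light_cone :: "nat set set \<Rightarrow> nat \<Rightarrow> nat set \<Rightarrow> nat set" where
  "light_cone E 0 T = T"
| "light_cone E (Suc p) T = neighbourhood E (light_cone E p T)"

lemma supported_heisenberg:
  assumes "supported T O1" and E: "finite E" "\<And>e. e \<in> E \<Longrightarrow> finite e \<and> e \<noteq> {}"
  shows "supported (light_cone E p T) (heisenberg n E p \<beta> \<gamma> O1)"
proof (induction p)
  case 0
  then show ?case using assms by (simp add: heisenberg_def)
next
  case (Suc p)
  show ?case unfolding heisenberg_Suc light_cone.simps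
    using supported_conj_phase[OF supported_conj_mixer[OF Suc] E] by blast
qed

lemma flips_opZ: "u \<in> S \<Longrightarrow> flips S (opZ u \<psi>) = (\<lambda>A. - opZ u (flips S \<psi>) A)"
  by (intro ext) (auto simp: flips_def opZ_def opD_def sgn_bit_def)

text \<open>The global flip commutes with every rotation and preserves every cut, so it passes
  through the circuit and its inverse; only \<open>opZ u\<close> in the middle contributes a
  sign.\<close>

lemma heisenberg_odd:
  assumes E: "\<And>e. e \<in> E \<Longrightarrow> finite e \<and> e \<noteq> {} \<and> e \<subseteq> {..<n}" and u: "u < n"
  shows "flips {..<n} (heisenberg n E p \<beta> \<gamma> (opZ u) \<psi>) =
    (\<lambda>A. - heisenberg n E p \<beta> \<gamma> (opZ u) (flips {..<n} \<psi>) A)"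
proof -
  have EM: "Min e \<in> {..<n} \<and> Max e \<in> {..<n}" if "e \<in> E" for e
    using E[OF that] Min_in[of e] Max_in[of e] by blast
  have c: "flips {..<n} \<circ> circuit_op n E p \<beta> \<gamma> = circuit_op n E p \<beta> \<gamma> \<circ> flips {..<n}"
  proof (induction p)
    case (Suc p)
    show ?case unfolding circuit_op.simps
      by (intro comm_comp Suc mixer_comm_flips[symmetric] phase_comm_flips[symmetric] EM finite_lessThan)
  qed simp
  have c': "flips {..<n} \<circ> circuit_inv n E p \<beta> \<gamma> = circuit_inv n E p \<beta> \<gamma> \<circ> flips {..<n}"
  proof (induction p)
    case (Suc p)
    show ?case unfolding circuit_inv.simps
      by (intro comm_comp Suc mixer_comm_flips[symmetric] phase_comm_flips[symmetric] EM finite_lessThan)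
  qed simp
  have lin: "linear_op (circuit_inv n E p \<beta> \<gamma>)"
    by (induction p) (auto simp del: comp_apply id_apply intro!: linear_op_comp)
  have "flips {..<n} (heisenberg n E p \<beta> \<gamma> (opZ u) \<psi>) =
      circuit_inv n E p \<beta> \<gamma> (flips {..<n} (opZ u (circuit_op n E p \<beta> \<gamma> \<psi>)))"
    using fun_cong[OF c'] by (simp add: heisenberg_def)
  also have "\<dots> = circuit_inv n E p \<beta> \<gamma> (\<lambda>A. - 1 * opZ u (circuit_op n E p \<beta> \<gamma> (flips {..<n} \<psi>)) A)"
    using u fun_cong[OF c, of \<psi>] by (simp add: flips_opZ)
  also have "\<dots> = (\<lambda>A. - heisenberg n E p \<beta> \<gamma> (opZ u) (flips {..<n} \<psi>) A)"
    unfolding linear_op_scale[OF lin] by (simp add: heisenberg_def)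
  finally show ?thesis .
qed

definition ip :: "nat \<Rightarrow> state \<Rightarrow> state \<Rightarrow> complex" where
  "ip n \<phi> \<psi> = (\<Sum>A\<in>Pow {..<n}. cnj (\<phi> A) * \<psi> A)"

lemma sum_Pow_flips:
  assumes "S \<subseteq> {..<n}"
  shows "(\<Sum>A\<in>Pow {..<n}. flips S \<psi> A) = (\<Sum>A\<in>Pow {..<n}. \<psi> A)"
  unfolding flips_def
  by (rule sum.reindex_bij_witness[where i = "\<lambda>A. sym_diff A S" and j = "\<lambda>A. sym_diff A S"])
    (use assms in auto)

text \<open>An odd operator anticommutes with the flip of the qubits in its support, which
  commutes with every operator supported elsewhere and fixes the uniform state.\<close>

lemma sum_heisenberg_ZZ_eq_0:
  assumes E: "finite E" "\<And>e. e \<in> E \<Longrightarrow> finite e \<and> e \<noteq> {} \<and> e \<subseteq> {..<n}" and uv: "u < n"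
    and disj: "light_cone E p {u} \<inter> light_cone E p {v} = {}"
  shows "(\<Sum>A\<in>Pow {..<n}.
    heisenberg n E p \<beta> \<gamma> (opZ u) (heisenberg n E p \<beta> \<gamma> (opZ v) (\<lambda>_. 1)) A) = 0"
proof -
  define Ou where "Ou = heisenberg n E p \<beta> \<gamma> (opZ u)"
  define Ov where "Ov = heisenberg n E p \<beta> \<gamma> (opZ v)"
  define S where "S = {..<n} \<inter> light_cone E p {u}"
  define S' where "S' = {..<n} - light_cone E p {u}"
  have supp: "supported (light_cone E p {u}) Ou" "supported (light_cone E p {v}) Ov"
    unfolding Ou_def Ov_def using E by (auto intro!: supported_heisenberg supported_opZ)
  have lin: "linear_op Ou" using supp by (simp add: supported_def)
  have cv: "Ov \<circ> flips S = flips S \<circ> Ov"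
    using supp(2) disj by (intro comm_flips) (auto simp: S_def supported_def)
  have cu: "Ou \<circ> flips S' = flips S' \<circ> Ou"
    using supp(1) by (intro comm_flips) (auto simp: S'_def supported_def)
  have SS': "flips S \<circ> flips S' = flips {..<n}"
    using flips_comp[of S S'] by (simp add: S_def S'_def Int_Diff Un_Diff_Int Un_commute disjoint_iff)
  \<comment> \<open>The global flip is \<open>flips S\<close> composed with \<open>flips S'\<close>,
    and \<open>S'\<close> avoids the support of \<open>Ou\<close>; so the sign under the global flip
    is due to \<open>flips S\<close> alone.\<close>
  have odd: "flips S (Ou \<psi>) = (\<lambda>A. - Ou (flips S \<psi>) A)" for \<psi>
  proof -
    have inv: "flips S' (flips S' \<phi>) = \<phi>" for \<phi> using fun_cong[OF flips_invol[of S'], of \<phi>] by simp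
    have "flips S (Ou \<psi>) = flips S (flips S' (Ou (flips S' \<psi>)))"
      using fun_cong[OF cu, of \<psi>] inv by simp
    also have "\<dots> = flips {..<n} (Ou (flips S' \<psi>))" using fun_cong[OF SS', of "Ou (flips S' \<psi>)"] by simp
    also have "\<dots> = (\<lambda>A. - Ou (flips {..<n} (flips S' \<psi>)) A)"
      unfolding Ou_def using E uv by (intro heisenberg_odd) auto
    also have "flips {..<n} (flips S' \<psi>) = flips S \<psi>"
      using fun_cong[OF SS', of "flips S' \<psi>"] inv by simp
    finally show ?thesis .
  qed
  \<comment> \<open>Applying \<open>flips S\<close> permutes the summands, while moving it inwards
    through \<open>Ou\<close> gives a sign and through \<open>Ov\<close> none; the sum equals its
    own negative.\<close>
  have "(\<Sum>A\<in>Pow {..<n}. Ou (Ov (\<lambda>_. 1)) A) = (\<Sum>A\<in>Pow {..<n}. flips S (Ou (Ov (\<lambda>_. 1))) A)"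
    by (rule sum_Pow_flips[symmetric]) (auto simp: S_def)
  also have "\<dots> = - (\<Sum>A\<in>Pow {..<n}. Ou (flips S (Ov (\<lambda>_. 1))) A)"
    unfolding odd by (simp add: sum_negf)
  also have "flips S (Ov (\<lambda>_. 1)) = Ov (flips S (\<lambda>_. 1))" using fun_cong[OF cv, of "\<lambda>_. 1"] by simp
  also have "flips S (\<lambda>_. 1) = (\<lambda>_. 1)" by (auto simp: flips_def)
  finally show ?thesis by (simp add: Ou_def Ov_def)
qed

section \<open>Adjoints and the distribution of measurement outcomes\<close>

lemma sum_Pow_flip:
  assumes "u < n"
  shows "(\<Sum>A\<in>Pow {..<n}. f (flip u A)) = (\<Sum>A\<in>Pow {..<n}. f A)"
  by (rule sum.reindex_bij_witness[where i = "flip u" and j = "flip u"])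
    (use assms in \<open>auto simp: flip_def split: if_splits\<close>)

lemma ip_rotX:
  assumes "u < n"
  shows "ip n (rotX b u \<phi>) \<psi> = ip n \<phi> (rotX (- b) u \<psi>)"
proof -
  have "(\<Sum>A\<in>Pow {..<n}. cnj (\<phi> (flip u A)) * \<psi> A) = (\<Sum>A\<in>Pow {..<n}. cnj (\<phi> A) * \<psi> (flip u A))"
    using sum_Pow_flip[OF assms, of "\<lambda>A. cnj (\<phi> A) * \<psi> (flip u A)"] by simp
  moreover have "ip n (rotX b u \<phi>) \<psi> = complex_of_real (cos b) * ip n \<phi> \<psi> -
      \<i> * complex_of_real (sin b) * (\<Sum>A\<in>Pow {..<n}. cnj (\<phi> (flip u A)) * \<psi> A)"
    unfolding ip_def rotX_def sum_distrib_left sum_subtractf[symmetric]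
    by (rule sum.cong) (auto simp: algebra_simps)
  moreover have "ip n \<phi> (rotX (- b) u \<psi>) = complex_of_real (cos b) * ip n \<phi> \<psi> -
      \<i> * complex_of_real (sin b) * (\<Sum>A\<in>Pow {..<n}. cnj (\<phi> A) * \<psi> (flip u A))"
    unfolding ip_def rotX_def sum_distrib_left sum_subtractf[symmetric]
    by (rule sum.cong) (auto simp: algebra_simps)
  ultimately show ?thesis by simp
qed

lemma ip_mixer:
  assumes "m \<le> n"
  shows "ip n (mixer_op b m \<phi>) \<psi> = ip n \<phi> (mixer_op (- b) m \<psi>)"
  using assms
proof (induction m arbitrary: \<phi> \<psi>)
  case (Suc m)
  have "mixer_op (- b) (Suc m) \<psi> = mixer_op (- b) m (rotX (- b) m \<psi>)"
    unfolding mixer_op_Suc' by simp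
  then show ?case using Suc by (simp add: ip_rotX)
qed simp

lemma ip_phase: "ip n (phase_op c E \<phi>) \<psi> = ip n \<phi> (phase_op (- c) E \<psi>)"
  by (simp add: ip_def phase_op_def opD_def cis_cnj mult_ac)

lemma ip_circuit: "ip n (circuit_op n E p \<beta> \<gamma> \<phi>) \<psi> = ip n \<phi> (circuit_inv n E p \<beta> \<gamma> \<psi>)"
  by (induction p arbitrary: \<phi> \<psi>) (simp_all add: ip_mixer ip_phase)

text \<open>The constant function 1 is the uniform superposition scaled by
  \<open>sqrt (2 ^ n)\<close>, whence the denominator.\<close>

definition outcome_prob ::
  "nat \<Rightarrow> nat set set \<Rightarrow> nat \<Rightarrow> (nat \<Rightarrow> real) \<Rightarrow> (nat \<Rightarrow> real) \<Rightarrow> nat set \<Rightarrow> real" where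
  "outcome_prob n E p \<beta> \<gamma> A = (cmod (circuit_op n E p \<beta> \<gamma> (\<lambda>_. 1) A))\<^sup>2 / 2 ^ n"

text \<open>Summing over all basis states is the inner product with the constant function. The
  inverse circuit is the adjoint, so it moves to the other side, and a diagonal observable then only
  weights squared amplitudes.\<close>

lemma sum_heisenberg_opD:
  fixes f :: "nat set \<Rightarrow> real"
  shows "(\<Sum>A\<in>Pow {..<n}. heisenberg n E p \<beta> \<gamma> (opD (\<lambda>A. complex_of_real (f A))) (\<lambda>_. 1) A) =
    2 ^ n * complex_of_real (\<Sum>A\<in>Pow {..<n}. outcome_prob n E p \<beta> \<gamma> A * f A)"
proof -
  let ?\<psi> = "circuit_op n E p \<beta> \<gamma> (\<lambda>_. 1)"
  have "(\<Sum>A\<in>Pow {..<n}. heisenberg n E p \<beta> \<gamma> (opD (\<lambda>A. complex_of_real (f A))) (\<lambda>_. 1) A) =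
      ip n (\<lambda>_. 1) (circuit_inv n E p \<beta> \<gamma> (opD (\<lambda>A. complex_of_real (f A)) ?\<psi>))"
    by (simp add: ip_def heisenberg_def)
  also have "\<dots> = ip n ?\<psi> (opD (\<lambda>A. complex_of_real (f A)) ?\<psi>)" by (simp add: ip_circuit)
  also have "\<dots> = (\<Sum>A\<in>Pow {..<n}. complex_of_real ((cmod (?\<psi> A))\<^sup>2 * f A))"
    unfolding ip_def opD_def by (intro sum.cong) (simp_all add: complex_norm_square mult_ac del: of_real_power)
  finally show ?thesis
    by (simp add: outcome_prob_def sum_distrib_left)
qed

lemma outcome_prob_nonneg: "outcome_prob n E p \<beta> \<gamma> A \<ge> 0"
  by (simp add: outcome_prob_def)

lemma sum_outcome_prob: "(\<Sum>A\<in>Pow {..<n}. outcome_prob n E p \<beta> \<gamma> A) = 1"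
proof -
  have "opD (\<lambda>_. complex_of_real 1) = id" by (auto simp: opD_def fun_eq_iff)
  then have "heisenberg n E p \<beta> \<gamma> (opD (\<lambda>_. complex_of_real 1)) (\<lambda>_. 1) = (\<lambda>_. 1)"
    by (simp add: heisenberg_def)
  then have "2 ^ n * complex_of_real (\<Sum>A\<in>Pow {..<n}. outcome_prob n E p \<beta> \<gamma> A) = 2 ^ n"
    using sum_heisenberg_opD[of n E p \<beta> \<gamma> "\<lambda>_. 1"] by (simp add: card_Pow)
  then have "complex_of_real (\<Sum>A\<in>Pow {..<n}. outcome_prob n E p \<beta> \<gamma> A) = complex_of_real 1" by simp
  then show ?thesis by (simp only: of_real_eq_iff)
qed

lemma outcome_correlation_eq_0:
  assumes E: "finite E" "\<And>e. e \<in> E \<Longrightarrow> finite e \<and> e \<noteq> {} \<and> e \<subseteq> {..<n}" and u: "u < n"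
    and disj: "light_cone E p {u} \<inter> light_cone E p {v} = {}"
  shows "(\<Sum>A\<in>Pow {..<n}. outcome_prob n E p \<beta> \<gamma> A * (sgn_bit A u * sgn_bit A v)) = 0"
proof -
  have op: "opD (\<lambda>A. complex_of_real (sgn_bit A u * sgn_bit A v)) = opZ u \<circ> opZ v"
    by (simp add: opZ_def opD_comp)
  have eq: "heisenberg n E p \<beta> \<gamma> (opZ u) \<circ> heisenberg n E p \<beta> \<gamma> (opZ v) =
      heisenberg n E p \<beta> \<gamma> (opZ u \<circ> opZ v)"
    by (rule ext) (simp add: heisenberg_def)
  have "2 ^ n * complex_of_real (\<Sum>A\<in>Pow {..<n}. outcome_prob n E p \<beta> \<gamma> A * (sgn_bit A u * sgn_bit A v)) = 0"
    unfolding sum_heisenberg_opD[symmetric] op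
    using sum_heisenberg_ZZ_eq_0[OF E u disj, of \<beta> \<gamma>] fun_cong[OF eq, of "\<lambda>_. 1"] by simp
  then show ?thesis by (simp only: mult_eq_0_iff of_real_eq_0_iff) simp
qed

subsection \<open>Matrices representing operators\<close>

lemma mem_set_decode: "u \<in> set_decode x \<longleftrightarrow> bit x u"
  by (simp add: set_decode_def bit_iff_odd)

lemma bij_betw_set_decode: "bij_betw set_decode {..<2 ^ n} (Pow {..<n})"
proof (rule bij_betw_byWitness[where f' = set_encode])
  show "set_decode ` {..<2 ^ n} \<subseteq> Pow {..<n}"
  proof (clarsimp simp: mem_set_decode)
    fix x u :: nat assume "x < 2 ^ n" "bit x u"
    then show "u < n" by (metis bit_take_bit_iff take_bit_nat_eq_self_iff)
  qed
  show "set_encode ` Pow {..<n} \<subseteq> {..<2 ^ n}"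
  proof clarsimp
    fix A :: "nat set" assume "A \<subseteq> {..<n}"
    then have "set_encode A \<le> (\<Sum>i<n. 2 ^ i)" unfolding set_encode_def by (intro sum_mono2) auto
    also have "\<dots> < 2 ^ n" by (simp add: sum_power2 flip: atLeast0LessThan)
    finally show "set_encode A < 2 ^ n" .
  qed
  show "\<forall>A\<in>Pow {..<n}. set_decode (set_encode A) = A"
    by (meson PowD finite_lessThan finite_subset set_encode_inverse)
qed simp

lemma sum_set_decode: "(\<Sum>x<2 ^ n. f (set_decode x)) = (\<Sum>A\<in>Pow {..<n}. f A)"
  by (rule sum.reindex_bij_betw[OF bij_betw_set_decode])

text \<open>States are functions on all sets of naturals, but this equation forces the result on
  subsets of \<open>{..<n}\<close> to depend only on values there. The operator determines the
  matrix, so operator identities yield matrix identities.\<close>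

definition represents :: "nat \<Rightarrow> complex mat \<Rightarrow> (state \<Rightarrow> state) \<Rightarrow> bool" where
  "represents n M O1 \<longleftrightarrow> M \<in> carrier_mat (2 ^ n) (2 ^ n) \<and>
     (\<forall>\<psi>. \<forall>x<2 ^ n. (\<Sum>y<2 ^ n. M $$ (x, y) * \<psi> (set_decode y)) = O1 \<psi> (set_decode x))"

lemma representsD:
  assumes "represents n M O1"
  shows "M \<in> carrier_mat (2 ^ n) (2 ^ n)"
    "x < 2 ^ n \<Longrightarrow> (\<Sum>y<2 ^ n. M $$ (x, y) * \<psi> (set_decode y)) = O1 \<psi> (set_decode x)"
  using assms by (auto simp: represents_def)

lemma represents_entry:
  assumes "represents n M O1" "x < 2 ^ n" "y < 2 ^ n"
  shows "M $$ (x, y) = O1 (\<lambda>A. of_bool (A = set_decode y)) (set_decode x)"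
proof -
  have "set_decode z = set_decode y \<longleftrightarrow> z = y" for z by (metis set_decode_inverse)
  then have "O1 (\<lambda>A. of_bool (A = set_decode y)) (set_decode x) =
      (\<Sum>z<2 ^ n. M $$ (x, z) * of_bool (z = y))"
    by (simp flip: representsD(2)[OF assms(1,2)])
  also have "\<dots> = M $$ (x, y)" using assms(3) by (simp add: of_bool_def if_distrib cong: if_cong)
  finally show ?thesis by simp
qed

lemma represents_unique:
  assumes "represents n M O1" "represents n M' O1"
  shows "M = M'"
  using representsD(1)[OF assms(1)] representsD(1)[OF assms(2)]
    represents_entry[OF assms(1)] represents_entry[OF assms(2)]
  by (intro eq_matI) auto

lemma represents_one: "represents n (1\<^sub>m (2 ^ n)) id"
  by (auto simp: represents_def if_distrib[of "\<lambda>c. c * _"] cong: if_cong)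

lemma represents_mult:
  assumes "represents n M O1" "represents n N O2"
  shows "represents n (M * N) (O1 \<circ> O2)"
  unfolding represents_def
proof (intro conjI allI impI)
  note M = representsD(1)[OF assms(1)] and N = representsD(1)[OF assms(2)]
  show "M * N \<in> carrier_mat (2 ^ n) (2 ^ n)" using M N by simp
  fix \<psi> :: state and x :: nat assume x: "x < 2 ^ n"
  have "(\<Sum>y<2 ^ n. (M * N) $$ (x, y) * \<psi> (set_decode y)) =
      (\<Sum>y<2 ^ n. \<Sum>z<2 ^ n. M $$ (x, z) * (N $$ (z, y) * \<psi> (set_decode y)))"
    using M N x by (intro sum.cong refl)
      (simp add: scalar_prod_def sum_distrib_right mult.assoc atLeast0LessThan)
  also have "\<dots> = (\<Sum>z<2 ^ n. \<Sum>y<2 ^ n. M $$ (x, z) * (N $$ (z, y) * \<psi> (set_decode y)))"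
    by (rule sum.swap)
  also have "\<dots> = (\<Sum>z<2 ^ n. M $$ (x, z) * O2 \<psi> (set_decode z))"
    by (simp add: representsD(2)[OF assms(2)] flip: sum_distrib_left)
  also have "\<dots> = (O1 \<circ> O2) \<psi> (set_decode x)" using representsD(2)[OF assms(1) x] by simp
  finally show "(\<Sum>y<2 ^ n. (M * N) $$ (x, y) * \<psi> (set_decode y)) = (O1 \<circ> O2) \<psi> (set_decode x)" .
qed

lemma represents_pow:
  assumes "represents n M O1"
  shows "represents n (M ^\<^sub>m k) (O1 ^^ k)"
proof (induction k)
  case 0
  then show ?case using represents_one[of n] representsD(1)[OF assms] by (simp add: id_def)
next
  case (Suc k)
  show ?case using represents_mult[OF Suc assms] by (simp only: pow_mat.simps funpow_Suc_right)
qed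

lemma represents_smult:
  assumes "represents n M O1"
  shows "represents n (c \<cdot>\<^sub>m M) (\<lambda>\<psi> A. c * O1 \<psi> A)"
  using representsD[OF assms]
  by (auto simp: represents_def mult.assoc simp flip: sum_distrib_left)

lemma represents_minus:
  assumes "represents n M O1" "represents n N O2"
  shows "represents n (M - N) (\<lambda>\<psi> A. O1 \<psi> A - O2 \<psi> A)"
  using representsD[OF assms(1)] representsD[OF assms(2)]
  by (auto simp: represents_def left_diff_distrib sum_subtractf)

lemma represents_mat_sum:
  assumes "\<And>s. s \<in> S \<Longrightarrow> represents n (F s) (O1 s)"
  shows "represents n (mat_sum (2 ^ n) F S) (\<lambda>\<psi> A. \<Sum>s\<in>S. O1 s \<psi> A)"
  unfolding represents_def
proof (intro conjI allI impI)
  show "mat_sum (2 ^ n) F S \<in> carrier_mat (2 ^ n) (2 ^ n)" by (simp add: mat_sum_def)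
  fix \<psi> :: state and x :: nat assume x: "x < 2 ^ n"
  have "(\<Sum>y<2 ^ n. mat_sum (2 ^ n) F S $$ (x, y) * \<psi> (set_decode y)) =
      (\<Sum>y<2 ^ n. \<Sum>s\<in>S. F s $$ (x, y) * \<psi> (set_decode y))"
    using x by (intro sum.cong refl) (simp add: mat_sum_def sum_distrib_right)
  also have "\<dots> = (\<Sum>s\<in>S. \<Sum>y<2 ^ n. F s $$ (x, y) * \<psi> (set_decode y))" by (rule sum.swap)
  also have "\<dots> = (\<Sum>s\<in>S. O1 s \<psi> (set_decode x))"
    by (intro sum.cong refl representsD(2)[OF assms x])
  finally show "(\<Sum>y<2 ^ n. mat_sum (2 ^ n) F S $$ (x, y) * \<psi> (set_decode y)) =
    (\<Sum>s\<in>S. O1 s \<psi> (set_decode x))" .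
qed

text \<open>The entries of \<open>mat_exp\<close> are values of \<open>suminf\<close>, which are
  meaningful only for convergent series. Applying the hypothesis to indicator states supplies the
  convergence of every entry.\<close>

lemma represents_mat_exp:
  assumes M: "represents n M O1"
    and sums: "\<And>\<psi> A. (\<lambda>k. (O1 ^^ k) \<psi> A / fact k) sums O2 \<psi> A"
  shows "represents n (mat_exp M) O2"
  unfolding represents_def
proof (intro conjI allI impI)
  note carrier = representsD(1)[OF M]
  then show "mat_exp M \<in> carrier_mat (2 ^ n) (2 ^ n)" by (auto simp: mat_exp_def)
  fix \<psi> :: state and x :: nat assume x: "x < 2 ^ n"
  have entry: "(\<lambda>k. (M ^\<^sub>m k) $$ (x, y) / fact k) sums mat_exp M $$ (x, y)" if y: "y < 2 ^ n" for y
  proof -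
    have "(\<lambda>k. (M ^\<^sub>m k) $$ (x, y) / fact k) sums O2 (\<lambda>A. of_bool (A = set_decode y)) (set_decode x)"
      unfolding represents_entry[OF represents_pow[OF M] x y] by (rule sums)
    moreover from sums_unique[OF this] have "mat_exp M $$ (x, y) = O2 (\<lambda>A. of_bool (A = set_decode y)) (set_decode x)"
      using carrier x y by (simp add: mat_exp_def)
    ultimately show ?thesis by simp
  qed
  have "(\<lambda>k. \<Sum>y<2 ^ n. (M ^\<^sub>m k) $$ (x, y) / fact k * \<psi> (set_decode y)) sums
      (\<Sum>y<2 ^ n. mat_exp M $$ (x, y) * \<psi> (set_decode y))"
    by (intro sums_sum sums_mult2 entry) simp
  moreover have "(\<Sum>y<2 ^ n. (M ^\<^sub>m k) $$ (x, y) / fact k * \<psi> (set_decode y)) =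
      (O1 ^^ k) \<psi> (set_decode x) / fact k" for k
    unfolding representsD(2)[OF represents_pow[OF M] x, symmetric]
    by (simp add: sum_divide_distrib)
  ultimately show "(\<Sum>y<2 ^ n. mat_exp M $$ (x, y) * \<psi> (set_decode y)) = O2 \<psi> (set_decode x)"
    using sums_unique2[OF _ sums[of \<psi> "set_decode x"]] by simp
qed

section \<open>Pauli matrices and the Ising Hamiltonian\<close>

lemma on_qubit_entry:
  assumes "u < n" "x < 2 ^ n" "y < 2 ^ n"
  shows "on_qubit n u A $$ (x, y) =
    of_bool (\<forall>v<n. v \<noteq> u \<longrightarrow> bit x v = bit y v) * A $$ (of_bool (bit x u), of_bool (bit y u))"
proof -
  have "on_qubit n u A $$ (x, y) =
      (\<Prod>v<n. (if v = u then A else 1\<^sub>m 2) $$ (of_bool (bit x v), of_bool (bit y v)))"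
    using assms by (simp add: on_qubit_def tensor_op_def)
  also have "\<dots> = A $$ (of_bool (bit x u), of_bool (bit y u)) *
      (\<Prod>v\<in>{..<n} - {u}. (if v = u then A else 1\<^sub>m 2) $$ (of_bool (bit x v), of_bool (bit y v)))"
    using assms(1) by (subst prod.remove[of _ u]) auto
  also have "(\<Prod>v\<in>{..<n} - {u}. (if v = u then A else 1\<^sub>m 2) $$ (of_bool (bit x v), of_bool (bit y v))) =
      (\<Prod>v\<in>{..<n} - {u}. of_bool (bit x v = bit y v))"
    by (intro prod.cong) auto
  also have "\<dots> = of_bool (\<forall>v<n. v \<noteq> u \<longrightarrow> bit x v = bit y v)"
    by (cases "\<forall>v<n. v \<noteq> u \<longrightarrow> bit x v = bit y v") (auto intro!: prod.neutral prod_zero)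
  finally show ?thesis by (simp add: mult.commute)
qed

lemma set_decode_sub: "x < 2 ^ n \<Longrightarrow> set_decode x \<subseteq> {..<n}"
  using bij_betw_set_decode[of n] by (auto simp: bij_betw_def)

lemma on_qubit_entry':
  assumes "u < n" "x < 2 ^ n" "y < 2 ^ n"
  shows "on_qubit n u A $$ (x, y) =
    of_bool (set_decode y = set_decode x \<or> set_decode y = flip u (set_decode x)) *
      A $$ (of_bool (u \<in> set_decode x), of_bool (u \<in> set_decode y))"
proof -
  have "(\<forall>v<n. v \<noteq> u \<longrightarrow> bit x v = bit y v) \<longleftrightarrow>
      set_decode y = set_decode x \<or> set_decode y = flip u (set_decode x)"
    using set_decode_sub[OF assms(2)] set_decode_sub[OF assms(3)]
    unfolding mem_set_decode[symmetric] set_eq_iff mem_flip by (auto simp: subset_iff)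
  then show ?thesis unfolding on_qubit_entry[OF assms] mem_set_decode[symmetric] by simp
qed

lemma represents_pauli_X:
  assumes u: "u < n"
  shows "represents n (pauli_X n u) (opX u)"
  unfolding represents_def
proof (intro conjI allI impI)
  show "pauli_X n u \<in> carrier_mat (2 ^ n) (2 ^ n)"
    by (simp add: pauli_X_def on_qubit_def tensor_op_def)
  fix \<psi> :: state and x :: nat assume x: "x < 2 ^ n"
  have "(\<Sum>y<2 ^ n. pauli_X n u $$ (x, y) * \<psi> (set_decode y)) =
      (\<Sum>y<2 ^ n. if set_decode y = flip u (set_decode x) then \<psi> (set_decode y) else 0)"
  proof (rule sum.cong[OF refl])
    fix y :: nat assume "y \<in> {..<2 ^ n}"
    then show "pauli_X n u $$ (x, y) * \<psi> (set_decode y) =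
        (if set_decode y = flip u (set_decode x) then \<psi> (set_decode y) else 0)"
      using on_qubit_entry'[OF u x, of y]
      by (auto simp: pauli_X_def mat_of_rows_list_def of_bool_def mem_flip)
  qed
  also have "\<dots> = (\<Sum>A\<in>Pow {..<n}. if A = flip u (set_decode x) then \<psi> A else 0)"
    by (rule sum_set_decode)
  also have "\<dots> = opX u \<psi> (set_decode x)"
    using set_decode_sub[OF x] u by (subst sum.delta) (auto simp: opX_def flip_def)
  finally show "(\<Sum>y<2 ^ n. pauli_X n u $$ (x, y) * \<psi> (set_decode y)) = opX u \<psi> (set_decode x)" .
qed

lemma represents_pauli_Z:
  assumes u: "u < n"
  shows "represents n (pauli_Z n u) (opZ u)"
  unfolding represents_def
proof (intro conjI allI impI)
  show "pauli_Z n u \<in> carrier_mat (2 ^ n) (2 ^ n)"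
    by (simp add: pauli_Z_def on_qubit_def tensor_op_def)
  fix \<psi> :: state and x :: nat assume x: "x < 2 ^ n"
  have "(\<Sum>y<2 ^ n. pauli_Z n u $$ (x, y) * \<psi> (set_decode y)) =
      (\<Sum>y<2 ^ n. if set_decode y = set_decode x then opZ u \<psi> (set_decode y) else 0)"
  proof (rule sum.cong[OF refl])
    fix y :: nat assume "y \<in> {..<2 ^ n}"
    then show "pauli_Z n u $$ (x, y) * \<psi> (set_decode y) =
        (if set_decode y = set_decode x then opZ u \<psi> (set_decode y) else 0)"
      using on_qubit_entry'[OF u x, of y]
      by (auto simp: pauli_Z_def mat_of_rows_list_def of_bool_def mem_flip opZ_def opD_def sgn_bit_def)
  qed
  also have "\<dots> = (\<Sum>A\<in>Pow {..<n}. if A = set_decode x then opZ u \<psi> A else 0)"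
    by (rule sum_set_decode)
  also have "\<dots> = opZ u \<psi> (set_decode x)"
    using set_decode_sub[OF x] by (subst sum.delta) auto
  finally show "(\<Sum>y<2 ^ n. pauli_Z n u $$ (x, y) * \<psi> (set_decode y)) = opZ u \<psi> (set_decode x)" .
qed

lemma represents_ising:
  assumes "\<And>e. e \<in> E \<Longrightarrow> finite e \<and> e \<noteq> {} \<and> e \<subseteq> {..<n}"
  shows "represents n (ising_hamiltonian n E) (opD (\<lambda>A. complex_of_real (cut_size E A)))"
proof -
  have EM: "Min e < n \<and> Max e < n" if "e \<in> E" for e
    using assms[OF that] Min_in[of e] Max_in[of e] by blast
  have "represents n (ising_hamiltonian n E)
      (\<lambda>\<psi> A. 1 / 2 * (\<Sum>e\<in>E. id \<psi> A - (opZ (Min e) \<circ> opZ (Max e)) \<psi> A))"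
    unfolding ising_hamiltonian_def using EM
    by (intro represents_smult represents_mat_sum represents_minus represents_one represents_mult
        represents_pauli_Z) auto
  moreover have "(\<lambda>\<psi> A. 1 / 2 * (\<Sum>e\<in>E. id \<psi> A - (opZ (Min e) \<circ> opZ (Max e)) \<psi> A)) =
      opD (\<lambda>A. complex_of_real (cut_size E A))"
  proof (intro ext)
    fix \<psi> :: state and A
    show "1 / 2 * (\<Sum>e\<in>E. id \<psi> A - (opZ (Min e) \<circ> opZ (Max e)) \<psi> A) =
        opD (\<lambda>A. complex_of_real (cut_size E A)) \<psi> A"
      unfolding opD_def cut_size_def of_real_sum sum_distrib_right sum_distrib_left
      by (intro sum.cong refl) (simp add: opZ_def opD_def field_simps)
  qed
  ultimately show ?thesis by simp
qed

section \<open>Exponentials of the Hamiltonian and of the mixer\<close>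

lemma opD_funpow: "opD f ^^ k = opD (\<lambda>A. f A ^ k)"
proof (induction k)
  case 0
  show ?case by (auto simp: opD_def fun_eq_iff)
next
  case (Suc k)
  then show ?case by (simp add: opD_comp)
qed

lemma exp_sums_complex: "(\<lambda>k. z ^ k / fact k) sums exp (z :: complex)"
  using exp_converges[of z] by (simp add: scaleR_conv_of_real divide_inverse mult.commute)

lemma represents_phase:
  assumes "represents n H (opD (\<lambda>A. complex_of_real (cut_size E A)))"
  shows "represents n (mat_exp ((\<i> * complex_of_real c) \<cdot>\<^sub>m H)) (phase_op c E)"
proof (rule represents_mat_exp)
  have "(\<lambda>\<psi> A. (\<i> * complex_of_real c) * opD (\<lambda>A. complex_of_real (cut_size E A)) \<psi> A) =
      opD (\<lambda>A. \<i> * complex_of_real (c * cut_size E A))"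
    by (intro ext) (simp add: opD_def mult.assoc)
  then show "represents n ((\<i> * complex_of_real c) \<cdot>\<^sub>m H) (opD (\<lambda>A. \<i> * complex_of_real (c * cut_size E A)))"
    using represents_smult[OF assms, of "\<i> * complex_of_real c"] by simp
  fix \<psi> :: state and A
  show "(\<lambda>k. (opD (\<lambda>A. \<i> * complex_of_real (c * cut_size E A)) ^^ k) \<psi> A / fact k) sums phase_op c E \<psi> A"
    unfolding opD_funpow using sums_mult2[OF exp_sums_complex, of "\<i> * complex_of_real (c * cut_size E A)" "\<psi> A"]
    by (simp add: opD_def phase_op_def cis_conv_exp mult_ac)
qed

text \<open>Splitting a state into the two eigenstates of \<open>X\<^sub>j\<close>, one qubit at a time,
  reduces the exponential of the mixer to scalars.\<close>

lemma mixer_exp_sums_aux: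
  fixes b :: real and n :: nat
  defines "B \<equiv> \<lambda>\<psi> A. (\<i> * complex_of_real b) * (\<Sum>u<n. opX u \<psi> A)"
  assumes "j \<le> n" "\<And>u. j \<le> u \<Longrightarrow> u < n \<Longrightarrow> \<exists>s\<in>{1, - 1 :: real}. opX u \<psi> = (\<lambda>A. complex_of_real s * \<psi> A)"
  shows "(\<lambda>k. (B ^^ k) \<psi> A / fact k) sums mixer_op b n \<psi> A"
  using assms(2,3)
\<comment> \<open>The assumption concerns the qubits from \<open>j\<close> on: at
  \<open>j = 0\<close> the state is a joint eigenstate of all \<open>opX u\<close>, and at
  \<open>j = n\<close> it is arbitrary.\<close>
proof (induction j arbitrary: \<psi>)
  case 0
  then have "\<forall>u\<in>{..<n}. \<exists>t. t \<in> {1, - 1 :: real} \<and> opX u \<psi> = (\<lambda>A. complex_of_real t * \<psi> A)"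
    by blast
  from bchoice[OF this] obtain s :: "nat \<Rightarrow> real" where
    "\<forall>u\<in>{..<n}. s u \<in> {1, - 1} \<and> opX u \<psi> = (\<lambda>A. complex_of_real (s u) * \<psi> A)"
    by (rule exE)
  then have s: "\<And>u. u < n \<Longrightarrow> s u \<in> {1, - 1}"
    "\<And>u. u < n \<Longrightarrow> opX u \<psi> = (\<lambda>A. complex_of_real (s u) * \<psi> A)"
    by simp_all
  \<comment> \<open>The eigenvalue of \<open>B\<close> at this joint eigenstate, on which the powers
    of \<open>B\<close> and the mixer all act as scalars.\<close>
  define l where "l = \<i> * complex_of_real (b * (\<Sum>u<n. s u))"
  have B: "B (\<lambda>A. c * \<psi> A) = (\<lambda>A. l * c * \<psi> A)" for c
  proof
    fix A
    have "(\<Sum>u<n. opX u (\<lambda>A. c * \<psi> A) A) = (\<Sum>u<n. complex_of_real (s u) * (c * \<psi> A))"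
      using s(2) by (intro sum.cong refl) (simp add: linear_op_scale[OF linear_op_opX])
    also have "\<dots> = complex_of_real (\<Sum>u<n. s u) * (c * \<psi> A)" by (simp add: sum_distrib_right)
    finally show "B (\<lambda>A. c * \<psi> A) A = l * c * \<psi> A"
      by (simp only: B_def l_def of_real_mult mult.assoc)
  qed
  have Bk: "(B ^^ k) \<psi> = (\<lambda>A. l ^ k * \<psi> A)" for k
    by (induction k) (simp_all add: B)
  have "mixer_op b m \<psi> = (\<lambda>A. cis (b * (\<Sum>u<m. s u)) * \<psi> A)" if "m \<le> n" for m
    using that
  proof (induction m)
    case (Suc m)
    have "complex_of_real (cos b) + \<i> * complex_of_real (sin b) * s m = cis (b * s m)"
      using s(1)[of m] Suc.prems by (auto simp: complex_eq_iff)
    moreover have "rotX b m \<psi> = (\<lambda>A. (complex_of_real (cos b) + \<i> * complex_of_real (sin b) * s m) * \<psi> A)"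
      using s(2)[of m] Suc.prems by (auto simp: rotX_def opX_def fun_eq_iff algebra_simps)
    ultimately have rot: "rotX b m \<psi> = (\<lambda>A. cis (b * s m) * \<psi> A)" by simp
    have IH: "mixer_op b m \<psi> = (\<lambda>A. cis (b * (\<Sum>u<m. s u)) * \<psi> A)" using Suc by simp
    show ?case
      unfolding mixer_op.simps comp_apply IH linear_op_scale[OF linear_op_rotX] rot
      by (simp add: distrib_left mult_ac flip: cis_mult)
  qed simp
  then have "mixer_op b n \<psi> A = exp l * \<psi> A" by (simp add: l_def cis_conv_exp)
  then show ?case
    unfolding Bk using sums_mult2[OF exp_sums_complex, of l "\<psi> A"] by (simp add: mult_ac)
next
  case (Suc j)
  have X_lin: "opX u (\<lambda>A. a * \<phi> A + c * \<chi> A) = (\<lambda>A. a * opX u \<phi> A + c * opX u \<chi> A)" for u a c \<phi> \<chi>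
    by (rule linear_opD[OF linear_op_opX])
  \<comment> \<open>The signs \<open>t = 1\<close> and \<open>t = - 1\<close> give the projections
    of \<open>\<psi>\<close> to the eigenspaces of \<open>opX j\<close>. They remain eigenstates at
    the later qubits because the \<open>opX u\<close> commute.\<close>
  have main: "(\<lambda>k. (B ^^ k) (\<lambda>A. 1 / 2 * \<psi> A + complex_of_real t / 2 * opX j \<psi> A) A / fact k) sums
      mixer_op b n (\<lambda>A. 1 / 2 * \<psi> A + complex_of_real t / 2 * opX j \<psi> A) A" if t: "t = 1 \<or> t = (- 1 :: real)" for t :: real
  proof (rule Suc.IH)
    show "j \<le> n" using Suc.prems by simp
    fix u assume u: "j \<le> u" "u < n"
    show "\<exists>s\<in>{1, - 1 :: real}. opX u (\<lambda>A. 1 / 2 * \<psi> A + complex_of_real t / 2 * opX j \<psi> A) =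
        (\<lambda>A. complex_of_real s * (1 / 2 * \<psi> A + complex_of_real t / 2 * opX j \<psi> A))"
    proof (cases "u = j")
      case True
      have "opX j (\<lambda>A. 1 / 2 * \<psi> A + complex_of_real t / 2 * opX j \<psi> A) =
          (\<lambda>A. complex_of_real t * (1 / 2 * \<psi> A + complex_of_real t / 2 * opX j \<psi> A))"
        unfolding X_lin using t by (auto simp: algebra_simps)
      then show ?thesis using True t by blast
    next
      case False
      then have "Suc j \<le> u" using u by simp
      from Suc.prems(2)[OF this u(2)] obtain s where
        s: "s \<in> {1, - 1 :: real}" "opX u \<psi> = (\<lambda>A. complex_of_real s * \<psi> A)" by (rule bexE)
      have "opX u (opX j \<psi>) = opX j (opX u \<psi>)" by (auto simp: opX_def flip_commute)
      also have "\<dots> = (\<lambda>A. s * opX j \<psi> A)" unfolding s(2) by (rule linear_op_scale) simp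
      finally have "opX u (\<lambda>A. 1 / 2 * \<psi> A + complex_of_real t / 2 * opX j \<psi> A) =
          (\<lambda>A. complex_of_real s * (1 / 2 * \<psi> A + complex_of_real t / 2 * opX j \<psi> A))"
        unfolding X_lin s(2) by (auto simp: algebra_simps)
      then show ?thesis using s(1) by blast
    qed
  qed
  have Blin: "linear_op (B ^^ k)" for k
  proof (induction k)
    case (Suc k)
    have "linear_op B"
      by (auto simp: linear_op_def B_def X_lin fun_eq_iff sum.distrib distrib_left sum_distrib_left mult_ac)
    then show ?case unfolding funpow.simps by (rule linear_op_comp[OF _ Suc])
  qed (simp add: linear_op_def)
  define \<psi>1 where "\<psi>1 = (\<lambda>A. 1 / 2 * \<psi> A + complex_of_real 1 / 2 * opX j \<psi> A)"
  define \<psi>2 where "\<psi>2 = (\<lambda>A. 1 / 2 * \<psi> A + complex_of_real (- 1) / 2 * opX j \<psi> A)"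
  have \<psi>: "\<psi> = (\<lambda>A. 1 * \<psi>1 A + 1 * \<psi>2 A)" by (auto simp: \<psi>1_def \<psi>2_def)
  have dec: "O1 \<psi> A = O1 \<psi>1 A + O1 \<psi>2 A" if "linear_op O1" for O1
    using fun_cong[OF linear_opD[OF that, of 1 \<psi>1 1 \<psi>2], of A] \<psi> by simp
  have "(\<lambda>k. (B ^^ k) \<psi>1 A / fact k + (B ^^ k) \<psi>2 A / fact k) sums (mixer_op b n \<psi>1 A + mixer_op b n \<psi>2 A)"
    unfolding \<psi>1_def \<psi>2_def by (intro sums_add main) auto
  then show ?case
    by (simp only: dec[OF Blin] dec[OF linear_op_mixer] add_divide_distrib)
qed

lemma represents_mixer:
  "represents n (mat_exp ((\<i> * complex_of_real b) \<cdot>\<^sub>m mixer n)) (mixer_op b n)"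
proof (rule represents_mat_exp)
  show "represents n ((\<i> * complex_of_real b) \<cdot>\<^sub>m mixer n)
      (\<lambda>\<psi> A. (\<i> * complex_of_real b) * (\<Sum>u<n. opX u \<psi> A))"
    unfolding mixer_def by (intro represents_smult represents_mat_sum represents_pauli_X) simp
  show "(\<lambda>k. ((\<lambda>\<psi> A. (\<i> * complex_of_real b) * (\<Sum>u<n. opX u \<psi> A)) ^^ k) \<psi> A / fact k)
      sums mixer_op b n \<psi> A" for \<psi> A
    by (rule mixer_exp_sums_aux[of n]) auto
qed

section \<open>The circuit and its inverse as matrices\<close>

lemma represents_circuit:
  assumes "represents n H (opD (\<lambda>A. complex_of_real (cut_size E A)))"
  shows "represents n (qaoa_circuit n H p \<beta> \<gamma>) (circuit_op n E p \<beta> \<gamma>)"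
proof (induction p)
  case 0
  show ?case unfolding circuit_op.simps qaoa_circuit.simps by (rule represents_one)
next
  case (Suc p)
  show ?case unfolding circuit_op.simps qaoa_circuit.simps
    by (intro represents_mult Suc represents_mixer represents_phase assms)
qed

lemma represents_circuit_inv:
  assumes "represents n H (opD (\<lambda>A. complex_of_real (cut_size E A)))"
  shows "\<exists>V. represents n V (circuit_inv n E p \<beta> \<gamma>)"
proof (induction p)
  case 0
  show ?case unfolding circuit_inv.simps using represents_one by blast
next
  case (Suc p)
  then obtain V where "represents n V (circuit_inv n E p \<beta> \<gamma>)" by blast
  then show ?case unfolding circuit_inv.simps
    using represents_mult[OF represents_mult[OF represents_phase[OF assms] represents_mixer]] by blast
qed

text \<open>The matrix of the explicit inverse operator shows that the circuit is a unit, which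
  rules out the result \<open>None\<close> of \<open>mat_inverse\<close>; uniqueness of inverses
  then identifies the two.\<close>

lemma represents_mat_inverse_circuit:
  assumes H: "represents n H (opD (\<lambda>A. complex_of_real (cut_size E A)))"
  shows "represents n (the (mat_inverse (qaoa_circuit n H p \<beta> \<gamma>))) (circuit_inv n E p \<beta> \<gamma>)"
proof -
  define U where "U = qaoa_circuit n H p \<beta> \<gamma>"
  have U: "represents n U (circuit_op n E p \<beta> \<gamma>)" unfolding U_def by (rule represents_circuit[OF H])
  obtain V where V: "represents n V (circuit_inv n E p \<beta> \<gamma>)" using represents_circuit_inv[OF H] by blast
  note cU = representsD(1)[OF U] and cV = representsD(1)[OF V]
  have id1: "circuit_op n E p \<beta> \<gamma> \<circ> circuit_inv n E p \<beta> \<gamma> = id"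
    and id2: "circuit_inv n E p \<beta> \<gamma> \<circ> circuit_op n E p \<beta> \<gamma> = id" by (rule ext, simp)+
  have UV: "U * V = 1\<^sub>m (2 ^ n)" and VU: "V * U = 1\<^sub>m (2 ^ n)"
    using represents_unique[OF represents_mult[OF U V, unfolded id1] represents_one]
      represents_unique[OF represents_mult[OF V U, unfolded id2] represents_one] by auto
  obtain W where W: "mat_inverse U = Some W"
  proof (cases "mat_inverse U")
    case None
    have "U \<in> Units (ring_mat TYPE(complex) (2 ^ n) ())"
      using cU cV UV VU by (auto simp: Units_def ring_mat_def)
    then show ?thesis using mat_inverse(1)[OF cU None, of "()"] by blast
  qed
  have UW: "U * W = 1\<^sub>m (2 ^ n)" and cW: "W \<in> carrier_mat (2 ^ n) (2 ^ n)"
    using mat_inverse(2)[OF cU W] by auto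
  have "W = (V * U) * W" using VU cW by simp
  also have "\<dots> = V * (U * W)" using cU cV cW by (intro assoc_mult_mat)
  also have "\<dots> = V" using UW cV by simp
  finally show ?thesis using V W by (simp add: U_def)
qed

section \<open>The energy as an expected cut\<close>

lemma plus_state_index:
  assumes "x < 2 ^ n"
  shows "plus_state n $ x = (1 / complex_of_real (sqrt 2)) ^ n"
proof -
  have "plus_state n $ x = (\<Prod>u<n. vec_of_list [1 / complex_of_real (sqrt 2), 1 / complex_of_real (sqrt 2)]
      $ of_bool (bit x u))"
    using assms by (simp add: plus_state_def tensor_state_def)
  also have "\<dots> = (\<Prod>u<n. 1 / complex_of_real (sqrt 2))"
    by (intro prod.cong refl) (auto simp: of_bool_def)
  finally have "plus_state n $ x = (\<Prod>u<n. 1 / complex_of_real (sqrt 2))" .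
  then show ?thesis by simp
qed

lemma expectation_value_plus:
  assumes "represents n M O1"
  shows "expectation_value M (plus_state n) = (\<Sum>A\<in>Pow {..<n}. O1 (\<lambda>_. 1) A) / 2 ^ n"
proof -
  define c where "c = (1 / complex_of_real (sqrt 2)) ^ n"
  have "complex_of_real (sqrt 2) * complex_of_real (sqrt 2) = 2"
    by (simp flip: of_real_mult)
  then have cc: "c * cnj c = 1 / 2 ^ n"
    by (simp add: c_def power_mult_distrib[symmetric] power_divide)
  have M: "M \<in> carrier_mat (2 ^ n) (2 ^ n)" using representsD(1)[OF assms] .
  have dim: "dim_vec (plus_state n) = 2 ^ n" by (simp add: plus_state_def tensor_state_def)
  have Mx: "(M *\<^sub>v plus_state n) $ x = c * O1 (\<lambda>_. 1) (set_decode x)" if x: "x < 2 ^ n" for x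
  proof -
    have "(M *\<^sub>v plus_state n) $ x = (\<Sum>y<2 ^ n. M $$ (x, y) * c)"
      using M x dim by (simp add: scalar_prod_def atLeast0LessThan plus_state_index c_def)
    then show ?thesis using representsD(2)[OF assms x, of "\<lambda>_. 1"]
      by (simp add: mult.commute flip: sum_distrib_left sum_distrib_right)
  qed
  have "expectation_value M (plus_state n) = (\<Sum>x<2 ^ n. (M *\<^sub>v plus_state n) $ x * cnj (plus_state n $ x))"
    using M dim by (simp add: expectation_value_def scalar_prod_def atLeast0LessThan)
  also have "\<dots> = (\<Sum>x<2 ^ n. (c * cnj c) * O1 (\<lambda>_. 1) (set_decode x))"
    by (intro sum.cong refl) (simp add: Mx plus_state_index c_def[symmetric] mult_ac del: complex_cnj_power)
  also have "\<dots> = 1 / 2 ^ n * (\<Sum>x<2 ^ n. O1 (\<lambda>_. 1) (set_decode x))"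
    unfolding cc by (simp add: sum_distrib_left)
  also have "\<dots> = (\<Sum>A\<in>Pow {..<n}. O1 (\<lambda>_. 1) A) / 2 ^ n" by (simp add: sum_set_decode)
  finally show ?thesis .
qed

lemma qaoa_energy_eq:
  assumes "\<And>e. e \<in> E \<Longrightarrow> finite e \<and> e \<noteq> {} \<and> e \<subseteq> {..<n}"
  shows "qaoa_energy n E p \<beta> \<gamma> = (\<Sum>A\<in>Pow {..<n}. outcome_prob n E p \<beta> \<gamma> A * cut_size E A)"
proof -
  let ?H = "ising_hamiltonian n E"
  have H: "represents n ?H (opD (\<lambda>A. complex_of_real (cut_size E A)))"
    by (rule represents_ising[OF assms])
  have "represents n (the (mat_inverse (qaoa_circuit n ?H p \<beta> \<gamma>)) * ?H * qaoa_circuit n ?H p \<beta> \<gamma>)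
      (heisenberg n E p \<beta> \<gamma> (opD (\<lambda>A. complex_of_real (cut_size E A))))"
    unfolding heisenberg_def
    by (intro represents_mult represents_mat_inverse_circuit represents_circuit H)
  then have "expectation_value (the (mat_inverse (qaoa_circuit n ?H p \<beta> \<gamma>)) * ?H * qaoa_circuit n ?H p \<beta> \<gamma>)
      (plus_state n) = complex_of_real (\<Sum>A\<in>Pow {..<n}. outcome_prob n E p \<beta> \<gamma> A * cut_size E A)"
    using sum_heisenberg_opD[of n E p \<beta> \<gamma> "cut_size E"] by (simp only: expectation_value_plus) simp
  then show ?thesis by (simp add: qaoa_energy_def Let_def)
qed

subsection \<open>The graph of a family of matchings\<close>

lemma card_eq_sum_of_bool: "S \<subseteq> {..<m :: nat} \<Longrightarrow> real (card S) = (\<Sum>v<m. of_bool (v \<in> S))"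
  by (simp add: of_bool_def sum.If_cases Int_absorb1)

definition matching_edges :: "nat \<Rightarrow> nat \<Rightarrow> (nat \<Rightarrow> nat \<Rightarrow> nat) \<Rightarrow> nat set set" where
  "matching_edges D m \<pi> = (\<lambda>(i, u). {u, m + \<pi> i u}) ` ({..<D} \<times> {..<m})"

context
  fixes D m :: nat and \<pi> :: "nat \<Rightarrow> nat \<Rightarrow> nat"
  assumes perm: "\<And>i. i < D \<Longrightarrow> \<pi> i permutes {..<m}"
    and no_collision: "collisions D m \<pi> = {}"
begin

lemma matching_lt: "i < D \<Longrightarrow> u < m \<Longrightarrow> \<pi> i u < m"
  using permutes_in_image[OF perm, of i u] by simp

lemma inj_on_matching_edges: "inj_on (\<lambda>(i, u). {u, m + \<pi> i u}) ({..<D} \<times> {..<m})"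
proof (rule inj_onI, clarsimp)
  fix i u j v assume *: "i < D" "u < m" "j < D" "v < m" "{u, m + \<pi> i u} = {v, m + \<pi> j v}"
  then have "u = v \<and> \<pi> i u = \<pi> j v" by (auto simp: doubleton_eq_iff)
  then show "i = j \<and> u = v" using no_collision * by (auto simp: collisions_def)
qed

lemma card_matching_edges: "card (matching_edges D m \<pi>) = D * m"
  by (simp add: matching_edges_def card_image inj_on_matching_edges)

lemma matching_edges_subset:
  "e \<in> matching_edges D m \<pi> \<Longrightarrow> finite e \<and> e \<noteq> {} \<and> e \<subseteq> {..<2 * m}"
  using matching_lt by (force simp: matching_edges_def)

lemma simple_matching_edges: "simple_graph {..<2 * m} (matching_edges D m \<pi>)"
  unfolding simple_graph_def
  using matching_edges_subset by (auto simp: matching_edges_def card_insert_if)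

lemma bipartite_matching_edges: "bipartite_graph {..<2 * m} (matching_edges D m \<pi>)"
  unfolding bipartite_graph_def
proof (intro conjI exI ballI simple_matching_edges)
  show "{..<m} \<union> {m..<2 * m} = {..<2 * m}" "{..<m} \<inter> {m..<2 * m} = {}" by auto
  fix e assume "e \<in> matching_edges D m \<pi>"
  then obtain i u where "i < D" "u < m" "e = {u, m + \<pi> i u}" by (auto simp: matching_edges_def)
  then show "\<exists>l\<in>{..<m}. \<exists>r\<in>{m..<2 * m}. e = {l, r}"
    using matching_lt[of i u] by (intro bexI[of _ u] bexI[of _ "m + \<pi> i u"]) auto
qed

text \<open>Each vertex lies on exactly one edge of every matching, on the right side because each
  \<open>\<pi> i\<close> is invertible, and without collisions these \<open>D\<close> edges are
  distinct.\<close>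

lemma regular_matching_edges: "regular_graph D {..<2 * m} (matching_edges D m \<pi>)"
  unfolding regular_graph_def
proof (intro conjI ballI simple_matching_edges)
  fix w assume w: "w \<in> {..<2 * m}"
  define S where "S = {(i, u) \<in> {..<D} \<times> {..<m}. w \<in> {u, m + \<pi> i u}}"
  have "{e \<in> matching_edges D m \<pi>. w \<in> e} = (\<lambda>(i, u). {u, m + \<pi> i u}) ` S"
    by (auto simp: matching_edges_def S_def)
  moreover have "inj_on (\<lambda>(i, u). {u, m + \<pi> i u}) S"
    by (rule inj_on_subset[OF inj_on_matching_edges]) (auto simp: S_def)
  ultimately have "card {e \<in> matching_edges D m \<pi>. w \<in> e} = card S" by (simp only: card_image)
  also have "card S = D"
  proof (cases "w < m")
    case True
    then have "S = {..<D} \<times> {w}" by (auto simp: S_def)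
    then show ?thesis by (simp add: card_cartesian_product)
  next
    case False
    define v where "v = w - m"
    have v: "w = m + v" "v < m" using w False by (auto simp: v_def)
    have "S = (\<lambda>i. (i, inv_into UNIV (\<pi> i) v)) ` {..<D}"
    proof (intro equalityI subsetI)
      fix x assume "x \<in> S"
      then obtain i u where x: "x = (i, u)" "i < D" "\<pi> i u = v" using v by (auto simp: S_def)
      then show "x \<in> (\<lambda>i. (i, inv_into UNIV (\<pi> i) v)) ` {..<D}"
        using permutes_inverses(2)[OF perm[OF x(2)], of u] by auto
    next
      fix x assume "x \<in> (\<lambda>i. (i, inv_into UNIV (\<pi> i) v)) ` {..<D}"
      then obtain i where x: "x = (i, inv_into UNIV (\<pi> i) v)" "i < D" by auto
      have "inv_into UNIV (\<pi> i) v < m"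
        using permutes_in_image[OF permutes_inv[OF perm[OF x(2)]], of v] v by simp
      then show "x \<in> S" using permutes_inverses(1)[OF perm[OF x(2)], of v] x v by (auto simp: S_def)
    qed
    moreover have "inj_on (\<lambda>i. (i, inv_into UNIV (\<pi> i) v)) {..<D}" by (rule inj_onI) simp
    ultimately show ?thesis by (simp add: card_image)
  qed
  finally show "card {e \<in> matching_edges D m \<pi>. w \<in> e} = D" .
qed

text \<open>The edge from \<open>u\<close> to \<open>m + \<pi> i u\<close> is uncut iff
  \<open>\<pi> i u\<close> lies in exactly one of \<open>B\<close> and the image of the left part,
  because \<open>B\<close> collects the right vertices outside \<open>A\<close>.\<close>

lemma cut_size_matching_edges:
  "cut_size (matching_edges D m \<pi>) A =
    real (D * m) - real (defect D \<pi> (A \<inter> {..<m}) {v. v < m \<and> m + v \<notin> A})"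
proof -
  define B where "B = {v. v < m \<and> m + v \<notin> A}"
  have row: "(\<Sum>u<m. (1 - sgn_bit A u * sgn_bit A (m + \<pi> i u)) / 2) =
      real m - real (card (sym_diff (\<pi> i ` (A \<inter> {..<m})) B))" if i: "i < D" for i
  proof -
    have sub: "\<pi> i ` (A \<inter> {..<m}) \<subseteq> {..<m}" using matching_lt[OF i] by auto
    have mem: "\<pi> i u \<in> \<pi> i ` (A \<inter> {..<m}) \<longleftrightarrow> u \<in> A" if "u < m" for u
      using that inj_image_mem_iff[OF permutes_inj[OF perm[OF i]], of u "A \<inter> {..<m}"] by simp
    have "real (card (sym_diff (\<pi> i ` (A \<inter> {..<m})) B)) =
        (\<Sum>v<m. of_bool (v \<in> sym_diff (\<pi> i ` (A \<inter> {..<m})) B))"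
      using sub by (intro card_eq_sum_of_bool) (auto simp: B_def)
    also have "\<dots> = (\<Sum>u<m. of_bool (\<pi> i u \<in> sym_diff (\<pi> i ` (A \<inter> {..<m})) B))"
      by (rule sum.permute[OF perm[OF i], unfolded comp_def])
    also have "\<dots> = (\<Sum>u<m. 1 - (1 - sgn_bit A u * sgn_bit A (m + \<pi> i u)) / 2)"
      using mem matching_lt[OF i] by (intro sum.cong refl) (auto simp: sgn_bit_def B_def)
    also have "\<dots> = real m - (\<Sum>u<m. (1 - sgn_bit A u * sgn_bit A (m + \<pi> i u)) / 2)"
      by (simp add: sum_subtractf)
    finally show ?thesis by simp
  qed
  have "cut_size (matching_edges D m \<pi>) A =
      (\<Sum>(i, u)\<in>{..<D} \<times> {..<m}. (1 - sgn_bit A u * sgn_bit A (m + \<pi> i u)) / 2)"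
    unfolding cut_size_def matching_edges_def sum.reindex[OF inj_on_matching_edges]
    by (intro sum.cong) auto
  also have "\<dots> = (\<Sum>i<D. \<Sum>u<m. (1 - sgn_bit A u * sgn_bit A (m + \<pi> i u)) / 2)"
    by (simp add: sum.cartesian_product)
  also have "\<dots> = (\<Sum>i<D. real m - real (card (sym_diff (\<pi> i ` (A \<inter> {..<m})) B)))"
    using row by (intro sum.cong) auto
  finally show ?thesis by (simp add: sum_subtractf defect_def B_def)
qed

end

section \<open>Size of light cones in regular graphs\<close>

definition reach :: "nat set set \<Rightarrow> (nat \<times> nat) set" where
  "reach E = {(v, w). v = w \<or> (\<exists>e\<in>E. v \<in> e \<and> w \<in> e)}"

text \<open>As a power of a reflexive symmetric relation, the light cone of a vertex is a ball of
  radius \<open>p\<close>, so membership in it is symmetric.\<close>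

lemma light_cone_eq: "light_cone E p T = (reach E ^^ p) `` T"
proof (induction p)
  case (Suc p)
  have "neighbourhood E T = reach E `` T" for T by (auto simp: neighbourhood_def reach_def)
  then show ?case using Suc by (simp add: relcomp_Image)
qed simp

lemma light_cone_sym: "w \<in> light_cone E p {v} \<longleftrightarrow> v \<in> light_cone E p {w}"
proof -
  have "(reach E)\<inverse> = reach E" by (auto simp: reach_def)
  then have "(reach E ^^ p)\<inverse> = reach E ^^ p"
    by (induction p) (simp_all add: converse_relcomp relpow_commute)
  then show ?thesis unfolding light_cone_eq by (auto simp: set_eq_iff)
qed

text \<open>Each layer multiplies the size by at most \<open>D + 1\<close>: a vertex brings itself
  and the far ends of its \<open>D\<close> edges.\<close>

lemma card_light_cone_le:
  assumes reg: "regular_graph D V E" and T: "T \<subseteq> V"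
  shows "light_cone E p T \<subseteq> V \<and> card (light_cone E p T) \<le> (D + 1) ^ p * card T"
proof (induction p)
  case 0
  then show ?case using T by simp
next
  case (Suc p)
  define S where "S = light_cone E p T"
  have S: "S \<subseteq> V" "card S \<le> (D + 1) ^ p * card T" using Suc by (auto simp: S_def)
  have V: "finite V" and E: "\<And>e. e \<in> E \<Longrightarrow> e \<subseteq> V \<and> card e = 2"
    and deg: "\<And>u. u \<in> V \<Longrightarrow> card {e \<in> E. u \<in> e} = D"
    using reg by (auto simp: regular_graph_def simple_graph_def)
  have finE: "finite E" by (rule finite_subset[of _ "Pow V"]) (use V E in auto)
  have finS: "finite S" using S V finite_subset by blast
  have one: "card (insert u (\<Union>e\<in>{e \<in> E. u \<in> e}. e - {u})) \<le> D + 1" if u: "u \<in> S" for u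
  proof -
    have "card (\<Union>e\<in>{e \<in> E. u \<in> e}. e - {u}) \<le> (\<Sum>e\<in>{e \<in> E. u \<in> e}. card (e - {u}))"
      using finE by (intro card_UN_le) auto
    also have "\<dots> = (\<Sum>e\<in>{e \<in> E. u \<in> e}. 1)"
      using E by (intro sum.cong refl) auto
    also have "\<dots> = D" using deg u S by auto
    finally have "card (\<Union>e\<in>{e \<in> E. u \<in> e}. e - {u}) \<le> D" .
    then show ?thesis by (intro card_insert_le_m1) simp_all
  qed
  have eq: "neighbourhood E S = (\<Union>u\<in>S. insert u (\<Union>e\<in>{e \<in> E. u \<in> e}. e - {u}))"
    by (auto simp: neighbourhood_def)
  have "card (neighbourhood E S) \<le> (\<Sum>u\<in>S. card (insert u (\<Union>e\<in>{e \<in> E. u \<in> e}. e - {u})))"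
    unfolding eq by (rule card_UN_le[OF finS])
  also have "\<dots> \<le> (\<Sum>u\<in>S. D + 1)" by (intro sum_mono one)
  also have "\<dots> = (D + 1) * card S" by simp
  also have "\<dots> \<le> (D + 1) * ((D + 1) ^ p * card T)" using S(2) by (rule mult_le_mono2)
  finally have "card (neighbourhood E S) \<le> (D + 1) ^ Suc p * card T" by (simp only: power_Suc mult.assoc)
  moreover have "neighbourhood E S \<subseteq> V" using S E by (auto simp: neighbourhood_def)
  ultimately show ?case by (simp only: light_cone.simps S_def)
qed

text \<open>If the light cones of \<open>u\<close> and \<open>v\<close> share a vertex
  \<open>w\<close>, then by symmetry \<open>v\<close> lies in the light cone of \<open>w\<close>, so
  such \<open>v\<close> are covered by the balls around the points of one ball.\<close>

lemma card_overlapping_light_cones_le: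
  assumes reg: "regular_graph D V E" and u: "u \<in> V"
  shows "card {v \<in> V. light_cone E p {u} \<inter> light_cone E p {v} \<noteq> {}} \<le> (D + 1) ^ (2 * p)"
proof -
  have V: "finite V" using reg by (auto simp: regular_graph_def simple_graph_def)
  define C where "C = light_cone E p {u}"
  have C: "C \<subseteq> V" "card C \<le> (D + 1) ^ p" using card_light_cone_le[OF reg, of "{u}" p] u by (auto simp: C_def)
  have "{v \<in> V. light_cone E p {u} \<inter> light_cone E p {v} \<noteq> {}} \<subseteq> (\<Union>w\<in>C. light_cone E p {w})"
    using light_cone_sym[of _ E p] by (auto simp: C_def)
  moreover have finC: "finite C" using C V finite_subset by blast
  moreover have fin: "finite (light_cone E p {w})" if "w \<in> C" for w
  proof (rule finite_subset[OF _ V])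
    show "light_cone E p {w} \<subseteq> V" using card_light_cone_le[OF reg, of "{w}" p] that C by auto
  qed
  ultimately have "card {v \<in> V. light_cone E p {u} \<inter> light_cone E p {v} \<noteq> {}} \<le>
      card (\<Union>w\<in>C. light_cone E p {w})"
    by (intro card_mono finite_UN_I)
  also have "\<dots> \<le> (\<Sum>w\<in>C. card (light_cone E p {w}))" by (rule card_UN_le[OF finC])
  also have "\<dots> \<le> (\<Sum>w\<in>C. (D + 1) ^ p)"
    using card_light_cone_le[OF reg, of "{_}" p] C by (intro sum_mono) auto
  also have "\<dots> = card C * (D + 1) ^ p" by simp
  also have "\<dots> \<le> (D + 1) ^ p * (D + 1) ^ p" using C(2) by (rule mult_le_mono1)
  finally show ?thesis by (simp only: mult_2 power_add)
qed

text \<open>Expanding the square gives pair correlations; those with disjoint light cones vanish,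
  and any other is at most 1.\<close>

lemma outcome_variance_le:
  assumes reg: "regular_graph D {..<n} E" and m: "m \<le> n"
  shows "(\<Sum>A\<in>Pow {..<n}. outcome_prob n E p \<beta> \<gamma> A * (\<Sum>u<m. sgn_bit A u)\<^sup>2) \<le> real (m * (D + 1) ^ (2 * p))"
proof -
  let ?q = "outcome_prob n E p \<beta> \<gamma>"
  have E: "e \<subseteq> {..<n} \<and> card e = 2" if "e \<in> E" for e
    using reg that by (auto simp: regular_graph_def simple_graph_def)
  have E': "finite e \<and> e \<noteq> {} \<and> e \<subseteq> {..<n}" if "e \<in> E" for e
    using E[OF that] by (auto intro: finite_subset)
  have finE: "finite E" by (rule finite_subset[of _ "Pow {..<n}"]) (use E in auto)
  define N where "N u = {v \<in> {..<n}. light_cone E p {u} \<inter> light_cone E p {v} \<noteq> {}}" for u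
  have corr: "(\<Sum>A\<in>Pow {..<n}. ?q A * (sgn_bit A u * sgn_bit A v)) \<le> of_bool (v \<in> N u)"
    if uv: "u < n" "v < n" for u v
  proof (cases "v \<in> N u")
    case True
    have "(\<Sum>A\<in>Pow {..<n}. ?q A * (sgn_bit A u * sgn_bit A v)) \<le> (\<Sum>A\<in>Pow {..<n}. ?q A * 1)"
      by (intro sum_mono mult_left_mono outcome_prob_nonneg) (simp add: sgn_bit_def)
    then show ?thesis using True sum_outcome_prob by simp
  next
    case False
    then have "light_cone E p {u} \<inter> light_cone E p {v} = {}" using uv by (auto simp: N_def)
    from outcome_correlation_eq_0[OF finE E' uv(1) this] show ?thesis by simp
  qed
  have "(\<Sum>A\<in>Pow {..<n}. ?q A * (\<Sum>u<m. sgn_bit A u)\<^sup>2) =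
      (\<Sum>A\<in>Pow {..<n}. \<Sum>u<m. \<Sum>v<m. ?q A * (sgn_bit A u * sgn_bit A v))"
    unfolding power2_eq_square sum_product unfolding sum_distrib_left by (rule refl)
  also have "\<dots> = (\<Sum>u<m. \<Sum>v<m. \<Sum>A\<in>Pow {..<n}. ?q A * (sgn_bit A u * sgn_bit A v))"
    by (subst sum.swap, rule sum.cong[OF refl], rule sum.swap)
  also have "\<dots> \<le> (\<Sum>u<m. \<Sum>v<m. of_bool (v \<in> N u))"
    using m by (intro sum_mono corr) auto
  also have "\<dots> \<le> (\<Sum>u<m. real ((D + 1) ^ (2 * p)))"
  proof (rule sum_mono)
    fix u assume u: "u \<in> {..<m}"
    have "(\<Sum>v<m. of_bool (v \<in> N u)) \<le> (\<Sum>v<n. of_bool (v \<in> N u) :: real)"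
      using m by (intro sum_mono2) auto
    also have "\<dots> = real (card (N u))"
      by (rule card_eq_sum_of_bool[symmetric]) (auto simp: N_def)
    also have "\<dots> \<le> real ((D + 1) ^ (2 * p))"
      using card_overlapping_light_cones_le[OF reg, of u p] u m by (intro of_nat_mono) (simp add: N_def)
    finally show "(\<Sum>v<m. of_bool (v \<in> N u)) \<le> real ((D + 1) ^ (2 * p))" .
  qed
  also have "\<dots> = real (m * (D + 1) ^ (2 * p))" by simp
  finally show ?thesis .
qed

text \<open>Chebyshev's inequality in integrated form: the cut is bounded pointwise by a quadratic
  function of the imbalance \<open>s A\<close>, whose expectation the second moment
  controls.\<close>

lemma qaoa_energy_matching_le:
  fixes f \<epsilon> :: real
  assumes perm: "\<And>i. i < D \<Longrightarrow> \<pi> i permutes {..<m}" and nc: "collisions D m \<pi> = {}"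
    and m: "m > 0" and f: "f \<ge> 0" and \<epsilon>: "\<epsilon> > 0"
    and expand: "\<And>A B. A \<subseteq> {..<m} \<Longrightarrow> B \<subseteq> {..<m} \<Longrightarrow> \<bar>real (card A) - m / 2\<bar> \<le> \<epsilon> * m \<Longrightarrow>
      f * D * m \<le> real (defect D \<pi> A B)"
  shows "qaoa_energy (2 * m) (matching_edges D m \<pi>) p \<beta> \<gamma> \<le>
    D * m * (1 - f + f * real ((D + 1) ^ (2 * p)) / (4 * \<epsilon>\<^sup>2 * m))"
proof -
  let ?n = "2 * m" and ?E = "matching_edges D m \<pi>"
  define q where "q = outcome_prob ?n ?E p \<beta> \<gamma>"
  define s where "s A = (\<Sum>u<m. sgn_bit A u)" for A
  have q: "q A \<ge> 0" for A by (simp add: q_def outcome_prob_nonneg)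
  have q1: "(\<Sum>A\<in>Pow {..<?n}. q A) = 1" by (simp add: q_def sum_outcome_prob)
  have s: "s A = real m - 2 * real (card (A \<inter> {..<m}))" for A
  proof -
    have "s A = (\<Sum>u<m. 1 - 2 * of_bool (u \<in> A))"
      unfolding s_def by (intro sum.cong) (auto simp: sgn_bit_def)
    also have "\<dots> = real m - 2 * (\<Sum>u<m. of_bool (u \<in> A))"
      by (simp add: sum_subtractf sum_distrib_left)
    also have "(\<Sum>u<m. of_bool (u \<in> A)) = real (card (A \<inter> {..<m}))"
      unfolding card_eq_sum_of_bool[OF Int_lower2] by (rule sum.cong) auto
    finally show ?thesis .
  qed
  have var: "(\<Sum>A\<in>Pow {..<?n}. q A * (s A)\<^sup>2) \<le> real (m * (D + 1) ^ (2 * p))"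
    unfolding q_def s_def by (intro outcome_variance_le regular_matching_edges[OF perm nc]) auto
  \<comment> \<open>As \<open>s A\<close> is twice the deviation of the left part from
    \<open>m / 2\<close> up to sign, balance reads
    \<open>\<bar>s A\<bar> \<le> 2 * \<epsilon> * m\<close>. For unbalanced \<open>A\<close> the
    quadratic term is at least \<open>f\<close>, and the trivial bound \<open>D * m\<close>
    suffices.\<close>
  have pt: "cut_size ?E A \<le> D * m * (1 - f + f * ((s A)\<^sup>2 / (2 * \<epsilon> * m)\<^sup>2))" for A
  proof -
    let ?d = "defect D \<pi> (A \<inter> {..<m}) {v. v < m \<and> m + v \<notin> A}"
    have "f * D * m * (1 - (s A)\<^sup>2 / (2 * \<epsilon> * m)\<^sup>2) \<le> real ?d"
    proof (cases "\<bar>s A\<bar> \<le> 2 * \<epsilon> * m")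
      case True
      have "f * D * m * (1 - (s A)\<^sup>2 / (2 * \<epsilon> * m)\<^sup>2) \<le> f * D * m * 1"
        using f by (intro mult_left_mono) auto
      also have "f * D * m * 1 \<le> real ?d"
        using True by (simp, intro expand) (auto simp: s)
      finally show ?thesis .
    next
      case False
      have "(2 * \<epsilon> * m)\<^sup>2 \<le> (s A)\<^sup>2"
        using False \<epsilon> by (intro abs_le_square_iff[THEN iffD1]) (auto simp: abs_mult)
      moreover have "(2 * \<epsilon> * m)\<^sup>2 > 0" using \<epsilon> m by simp
      ultimately have "1 - (s A)\<^sup>2 / (2 * \<epsilon> * m)\<^sup>2 \<le> 0" by simp
      then have "f * D * m * (1 - (s A)\<^sup>2 / (2 * \<epsilon> * m)\<^sup>2) \<le> 0"
        using f by (intro mult_nonneg_nonpos) auto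
      then show ?thesis by linarith
    qed
    then have "real (D * m) - real ?d \<le> real (D * m) - f * D * m * (1 - (s A)\<^sup>2 / (2 * \<epsilon> * m)\<^sup>2)"
      by (rule diff_left_mono)
    moreover have "real (D * m) - f * D * m * (1 - x) = D * m * (1 - f + f * x)" for x
      by (simp add: algebra_simps)
    moreover have "cut_size ?E A = real (D * m) - real ?d"
      by (intro cut_size_matching_edges perm nc)
    ultimately show ?thesis by (simp only:)
  qed
  have "qaoa_energy ?n ?E p \<beta> \<gamma> = (\<Sum>A\<in>Pow {..<?n}. q A * cut_size ?E A)"
    unfolding q_def by (intro qaoa_energy_eq matching_edges_subset[OF perm nc])
  also have "\<dots> \<le> (\<Sum>A\<in>Pow {..<?n}. q A * (D * m * (1 - f + f * ((s A)\<^sup>2 / (2 * \<epsilon> * m)\<^sup>2))))"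
    by (intro sum_mono mult_left_mono pt q)
  also have "\<dots> = (\<Sum>A\<in>Pow {..<?n}. D * m * (1 - f) * q A + D * m * f / (2 * \<epsilon> * m)\<^sup>2 * (q A * (s A)\<^sup>2))"
    by (intro sum.cong refl) (simp add: algebra_simps)
  also have "\<dots> = D * m * (1 - f) + D * m * f / (2 * \<epsilon> * m)\<^sup>2 * (\<Sum>A\<in>Pow {..<?n}. q A * (s A)\<^sup>2)"
    unfolding sum.distrib sum_distrib_left[symmetric] q1 by simp
  also have "\<dots> \<le> D * m * (1 - f) + D * m * f / (2 * \<epsilon> * m)\<^sup>2 * real (m * (D + 1) ^ (2 * p))"
    using f var by (intro add_left_mono mult_left_mono) auto
  also have "\<dots> = D * m * (1 - f + f * real ((D + 1) ^ (2 * p)) / (4 * \<epsilon>\<^sup>2 * m))"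
    using m \<epsilon> by (simp add: field_simps power2_eq_square del: of_nat_power of_nat_add of_nat_Suc)
  finally show ?thesis by (simp only: of_nat_mult)
qed

text \<open>By \<open>D + 1 \<le> 2 ^ D\<close> the left side is at most
  \<open>2 powr (2 * D * p)\<close>. The bound on \<open>p\<close> turns the exponent into
  \<open>2 / 3 * log 2 n - 8\<close>, whence \<open>256 = 2 ^ 8\<close>.\<close>

lemma light_cone_volume_le:
  assumes n: "n > 0" and D: "D \<ge> 1" and p: "real p < (1 / 3 * log 2 (real n) - 4) * inverse (real D)"
  shows "real ((D + 1) ^ (2 * p)) \<le> real n powr (2 / 3) / 256"
proof -
  have "D + 1 \<le> 2 ^ D" by (induction D) auto
  then have "(D + 1) ^ (2 * p) \<le> (2 ^ D) ^ (2 * p)" by (rule power_mono) simp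
  then have "real ((D + 1) ^ (2 * p)) \<le> real ((2 ^ D) ^ (2 * p))" by (rule of_nat_mono)
  also have "\<dots> = 2 powr (2 * (D * p))"
    by (simp add: powr_realpow[symmetric] powr_powr mult_ac flip: power_mult)
  also have "\<dots> \<le> 2 powr (2 / 3 * log 2 n - 8)"
    using p D by (intro powr_mono) (auto simp: field_simps)
  also have "\<dots> = (2 powr log 2 n) powr (2 / 3) / 2 powr 8"
    by (simp add: powr_diff powr_powr mult.commute)
  also have "\<dots> = real n powr (2 / 3) / 256" using n by simp
  finally show ?thesis .
qed

theorem corollary1:
  fixes D :: nat
  assumes "D \<ge> 3"
  shows "\<exists>(I :: nat set) (E :: nat \<Rightarrow> nat set set).
    infinite I \<and>
    (\<forall>n\<in>I. n > 0 \<and> bipartite_graph {..<n} (E n) \<and> regular_graph D {..<n} (E n) \<and>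
      (\<forall>(p :: nat) (\<beta> :: nat \<Rightarrow> real) (\<gamma> :: nat \<Rightarrow> real).
        p \<ge> 1 \<longrightarrow> real p < (1 / 3 * log 2 (real n) - 4) * inverse (real D) \<longrightarrow>
        1 / real (card (E n)) * qaoa_energy n (E n) p \<beta> \<gamma>
          \<le> 5 / 6 + sqrt (real D - 1) / (3 * real D)))"
proof -
  define c where "c = (1 - 2 * sqrt (real D - 1) / D) / 6"
  obtain f \<epsilon> :: real where f: "c < f" and \<epsilon>: "\<epsilon> > 0"
    and ev: "\<forall>\<^sub>F m in sequentially. \<exists>\<pi>. (\<forall>i<D. \<pi> i permutes {..<m}) \<and> collisions D m \<pi> = {} \<and>
      (\<forall>A B. A \<subseteq> {..<m} \<longrightarrow> B \<subseteq> {..<m} \<longrightarrow> \<bar>real (card A) - m / 2\<bar> \<le> \<epsilon> * m \<longrightarrow>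
        f * D * m \<le> real (defect D \<pi> A B))"
    using exists_expanding_matchings[OF assms] unfolding c_def by blast
  \<comment> \<open>From \<open>(D - 2)\<^sup>2 \<ge> 0\<close>. It yields \<open>f \<ge> 0\<close>,
    by which the Chebyshev term is multiplied.\<close>
  have "c \<ge> 0"
  proof -
    have "sqrt (real D - 1) \<le> real D / 2"
      using zero_le_power2[of "real D - 2"] assms
      by (intro real_le_lsqrt) (auto simp: power2_eq_square algebra_simps)
    then show ?thesis using assms by (simp add: c_def field_simps)
  qed
  then have f0: "f \<ge> 0" using f by simp
  \<comment> \<open>The overlap of light cones is sublinear in \<open>m\<close>, so the Chebyshev
    error eventually fits into the gap \<open>f - c\<close>, uniformly in \<open>p\<close> and the
    angles.\<close>
  have "(\<lambda>m. f * ((2 * real m) powr (2 / 3) / 256) / (4 * \<epsilon>\<^sup>2 * real m)) \<longlonglongrightarrow> 0"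
    using \<epsilon> by real_asymp
  then have "\<forall>\<^sub>F m in sequentially. f * ((2 * real m) powr (2 / 3) / 256) / (4 * \<epsilon>\<^sup>2 * real m) < f - c"
    using f by (intro order_tendstoD(2)) auto
  from eventually_conj[OF ev this] obtain M where M: "\<And>m. m \<ge> M \<Longrightarrow>
      (\<exists>\<pi>. (\<forall>i<D. \<pi> i permutes {..<m}) \<and> collisions D m \<pi> = {} \<and>
      (\<forall>A B. A \<subseteq> {..<m} \<longrightarrow> B \<subseteq> {..<m} \<longrightarrow> \<bar>real (card A) - m / 2\<bar> \<le> \<epsilon> * m \<longrightarrow>
        f * D * m \<le> real (defect D \<pi> A B))) \<and>
      f * ((2 * real m) powr (2 / 3) / 256) / (4 * \<epsilon>\<^sup>2 * real m) < f - c"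
    unfolding eventually_sequentially by blast
  \<comment> \<open>Sizes are even because both sides have \<open>m\<close> vertices;
    \<open>max M 1\<close> keeps them positive.\<close>
  define I where "I = (\<lambda>m. 2 * m) ` {max M 1..}"
  have "infinite I" unfolding I_def
    by (subst finite_image_iff) (auto simp: inj_on_def infinite_Ici)
  have "\<exists>E. n > 0 \<and> bipartite_graph {..<n} E \<and> regular_graph D {..<n} E \<and>
      (\<forall>(p :: nat) (\<beta> :: nat \<Rightarrow> real) (\<gamma> :: nat \<Rightarrow> real).
        p \<ge> 1 \<longrightarrow> real p < (1 / 3 * log 2 (real n) - 4) * inverse (real D) \<longrightarrow>
        1 / real (card E) * qaoa_energy n E p \<beta> \<gamma> \<le> 5 / 6 + sqrt (real D - 1) / (3 * real D))"
    if n: "n \<in> I" for n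
  proof -
    obtain m where m: "m \<ge> M" "m \<ge> 1" "n = 2 * m" using n by (auto simp: I_def)
    obtain \<pi> where perm: "\<And>i. i < D \<Longrightarrow> \<pi> i permutes {..<m}" and nc: "collisions D m \<pi> = {}"
      and expand: "\<And>A B. A \<subseteq> {..<m} \<Longrightarrow> B \<subseteq> {..<m} \<Longrightarrow> \<bar>real (card A) - m / 2\<bar> \<le> \<epsilon> * m \<Longrightarrow>
        f * D * m \<le> real (defect D \<pi> A B)"
      using M[OF m(1)] by blast
    have small: "f * ((2 * real m) powr (2 / 3) / 256) / (4 * \<epsilon>\<^sup>2 * real m) < f - c"
      using M[OF m(1)] by blast
    let ?E = "matching_edges D m \<pi>"
    have "1 / real (card ?E) * qaoa_energy n ?E p \<beta> \<gamma> \<le> 5 / 6 + sqrt (real D - 1) / (3 * real D)"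
      if p: "real p < (1 / 3 * log 2 (real n) - 4) * inverse (real D)" for p \<beta> \<gamma>
    proof -
      have vol: "real ((D + 1) ^ (2 * p)) \<le> (2 * real m) powr (2 / 3) / 256"
        using light_cone_volume_le[OF _ _ p] m assms by simp
      have "f * real ((D + 1) ^ (2 * p)) / (4 * \<epsilon>\<^sup>2 * m) \<le>
          f * ((2 * real m) powr (2 / 3) / 256) / (4 * \<epsilon>\<^sup>2 * real m)"
        using f0 vol by (intro divide_right_mono mult_left_mono) auto
      also note small
      finally have "1 - f + f * real ((D + 1) ^ (2 * p)) / (4 * \<epsilon>\<^sup>2 * m) \<le> 1 - c" by linarith
      then have "D * m * (1 - f + f * real ((D + 1) ^ (2 * p)) / (4 * \<epsilon>\<^sup>2 * m)) \<le> D * m * (1 - c)"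
        by (intro mult_left_mono) auto
      with qaoa_energy_matching_le[OF perm nc _ f0 \<epsilon> expand, of p \<beta> \<gamma>] m
      have "qaoa_energy n ?E p \<beta> \<gamma> \<le> D * m * (1 - c)" by simp
      then have "1 / real (card ?E) * qaoa_energy n ?E p \<beta> \<gamma> \<le> 1 - c"
        using assms m by (simp add: card_matching_edges[OF perm nc] field_simps)
      also have "1 - c = 5 / 6 + sqrt (real D - 1) / (3 * real D)"
        using assms by (simp add: c_def field_simps)
      finally show ?thesis .
    qed
    then show ?thesis
      using m bipartite_matching_edges[OF perm nc] regular_matching_edges[OF perm nc]
      by (intro exI[of _ ?E]) auto
  qed
  then have "\<forall>n\<in>I. \<exists>E. n > 0 \<and> bipartite_graph {..<n} E \<and> regular_graph D {..<n} E \<and>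
      (\<forall>(p :: nat) (\<beta> :: nat \<Rightarrow> real) (\<gamma> :: nat \<Rightarrow> real).
        p \<ge> 1 \<longrightarrow> real p < (1 / 3 * log 2 (real n) - 4) * inverse (real D) \<longrightarrow>
        1 / real (card E) * qaoa_energy n E p \<beta> \<gamma> \<le> 5 / 6 + sqrt (real D - 1) / (3 * real D))"
    by blast
  from bchoice[OF this] \<open>infinite I\<close> show ?thesis by blast
qed

end
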